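(* Let $x_0\in\{a=0\}$ be an accumulation point of $A$, let $\lambda>\lambda_0$, let $f\in C^1(A)$ be a bounded solution of $a(x)f'+H(x,f)=\lambda$ in $A$, and let $u_{\lambda_0}$ be a Lipschitz viscosity solution of $a u''+H(x,u')=\lambda_0$ in $\mathbb R$. Then $\hat\lambda(x_0)\le\lambda_0$ and: (a) if $f\ge u'_{\lambda_0}$ on $A$, then $\lim_{x\to x_0,\,x\in A}f(x)=p^+_\lambda(x_0)>p^+_{\lambda_0}(x_0)\ge\hat p(x_0)$; (b) if $f\le u'_{\lambda_0}$ on $A$, then $\lim_{x\to x_0,\,x\in A}f(x)=p^-_\lambda(x_0)<p^-_{\lambda_0}(x_0)\le\hat p(x_0)$.
   Context: Deterministic setting: $a:\mathbb R\to[0,1]$ with $\sqrt a$ $\kappa$-Lipschitz and (A1$'$): $a\not\equiv0$ and every connected component of $A:=\{a>0\}$ is a bounded interval. $H\in\mathscr H_{sqc}(\alpha_0,\alpha_1,\gamma,\eta)$, $\gamma>2$, $\eta>0$: (H1) $\alpha_0|p|^\gamma-1/\alpha_0\le H(x,p)\le\alpha_1(|p|^\gamma+1)$, (H2) $|H(x,p)-H(x,q)|\le\alpha_1(|p|+|q|+1)^{\gamma-1}|p-q|$, (H3) $|H(x,p)-H(y,p)|\le\alpha_1(|p|^\gamma+1)|x-y|$, $H(x,\cdot)$ strictly quasiconvex with unique minimizer $\hat p(x)$, $H(x,p_1)-H(x,p_2)\ge\eta|p_1-p_2|$ for $p_1<p_2\le\hat p(x)$, $H(x,p_2)-H(x,p_1)\ge\eta|p_1-p_2|$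 for $p_2>p_1\ge\hat p(x)$. $\hat\lambda(x):=\min_pH(x,p)$; for $\lambda\ge\hat\lambda(x)$, $\{p:H(x,p)\le\lambda\}=[p^-_\lambda(x),p^+_\lambda(x)]$. $\lambda_0:=\inf\{\lambda:\ a u''+H(x,u')=\lambda$ admits a continuous viscosity supersolution on $\mathbb R\}$ (supersolution: $a\varphi''+H(x,\varphi')\le\lambda$ for $C^2$ $\varphi$ touching from below; subsolution: $\ge\lambda$ from above). Lipschitz viscosity solutions are $C^2$ on $A$, so $u'_{\lambda_0}$ is $C^1$ on $A$. *)

theory Defs
  imports "HOL-Analysis.Analysis"
begin

definition diffusion_ok :: "real \<Rightarrow> (real \<Rightarrow> real) \<Rightarrow> bool" where
  "diffusion_ok \<kappa> a \<longleftrightarrow>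
     (\<forall>x. 0 \<le> a x \<and> a x \<le> 1) \<and>
     \<kappa>-lipschitz_on UNIV (\<lambda>x. sqrt (a x)) \<and>
     (\<exists>x. a x \<noteq> 0) \<and>
     (\<forall>x\<in>{y. a y > 0}. is_interval (connected_component_set {y. a y > 0} x)
                        \<and> bounded (connected_component_set {y. a y > 0} x))"

definition H_sqc :: "real \<Rightarrow> real \<Rightarrow> real \<Rightarrow> real \<Rightarrow> (real \<Rightarrow> real \<Rightarrow> real) \<Rightarrow> bool" where
  "H_sqc \<alpha>0 \<alpha>1 \<gamma> \<eta> H \<longleftrightarrow>
     \<alpha>0 > 0 \<and> \<alpha>1 > 0 \<and> \<gamma> > 2 \<and> \<eta> > 0 \<and>
     (\<forall>x p. \<alpha>0 * \<bar>p\<bar> powr \<gamma> - 1 / \<alpha>0 \<le> H x p \<and> H x p \<le> \<alpha>1 * (\<bar>p\<bar> powr \<gamma> + 1)) \<and>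
     (\<forall>x p q. \<bar>H x p - H x q\<bar> \<le> \<alpha>1 * (\<bar>p\<bar> + \<bar>q\<bar> + 1) powr (\<gamma> - 1) * \<bar>p - q\<bar>) \<and>
     (\<forall>x y p. \<bar>H x p - H y p\<bar> \<le> \<alpha>1 * (\<bar>p\<bar> powr \<gamma> + 1) * \<bar>x - y\<bar>) \<and>
     (\<forall>x p q t. p \<noteq> q \<and> 0 < t \<and> t < 1 \<longrightarrow>
          H x (t * p + (1 - t) * q) < max (H x p) (H x q)) \<and>
     (\<forall>x. \<exists>ph. (\<forall>p. p \<noteq> ph \<longrightarrow> H x ph < H x p) \<and>
          (\<forall>p1 p2. p1 < p2 \<and> p2 \<le> ph \<longrightarrow> H x p1 - H x p2 \<ge> \<eta> * \<bar>p1 - p2\<bar>) \<and>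
          (\<forall>p1 p2. p1 < p2 \<and> p1 \<ge> ph \<longrightarrow> H x p2 - H x p1 \<ge> \<eta> * \<bar>p1 - p2\<bar>))"

definition hat_p :: "(real \<Rightarrow> real \<Rightarrow> real) \<Rightarrow> real \<Rightarrow> real" where
  "hat_p H x = (THE ph. \<forall>p. H x ph \<le> H x p)"

definition hat_lambda :: "(real \<Rightarrow> real \<Rightarrow> real) \<Rightarrow> real \<Rightarrow> real" where
  "hat_lambda H x = (INF p. H x p)"

definition p_plus :: "(real \<Rightarrow> real \<Rightarrow> real) \<Rightarrow> real \<Rightarrow> real \<Rightarrow> real" where
  "p_plus H c x = Sup {p. H x p \<le> c}"

definition p_minus :: "(real \<Rightarrow> real \<Rightarrow> real) \<Rightarrow> real \<Rightarrow> real \<Rightarrow> real" where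
  "p_minus H c x = Inf {p. H x p \<le> c}"

definition C2_fun :: "(real \<Rightarrow> real) \<Rightarrow> (real \<Rightarrow> real) \<Rightarrow> (real \<Rightarrow> real) \<Rightarrow> bool" where
  "C2_fun \<phi> \<phi>1 \<phi>2 \<longleftrightarrow>
     (\<forall>y. (\<phi> has_real_derivative \<phi>1 y) (at y)) \<and>
     (\<forall>y. (\<phi>1 has_real_derivative \<phi>2 y) (at y)) \<and> continuous_on UNIV \<phi>2"

definition visc_super :: "(real \<Rightarrow> real) \<Rightarrow> (real \<Rightarrow> real \<Rightarrow> real) \<Rightarrow> real \<Rightarrow> (real \<Rightarrow> real) \<Rightarrow> bool" where
  "visc_super a H c u \<longleftrightarrow> continuous_on UNIV u \<and>
     (\<forall>\<phi> \<phi>1 \<phi>2 x0. C2_fun \<phi> \<phi>1 \<phi>2 \<and> \<phi> x0 = u x0 \<and>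
        (\<exists>e>0. \<forall>y. \<bar>y - x0\<bar> < e \<longrightarrow> \<phi> y \<le> u y)
        \<longrightarrow> a x0 * \<phi>2 x0 + H x0 (\<phi>1 x0) \<le> c)"

definition visc_sub :: "(real \<Rightarrow> real) \<Rightarrow> (real \<Rightarrow> real \<Rightarrow> real) \<Rightarrow> real \<Rightarrow> (real \<Rightarrow> real) \<Rightarrow> bool" where
  "visc_sub a H c u \<longleftrightarrow> continuous_on UNIV u \<and>
     (\<forall>\<phi> \<phi>1 \<phi>2 x0. C2_fun \<phi> \<phi>1 \<phi>2 \<and> \<phi> x0 = u x0 \<and>
        (\<exists>e>0. \<forall>y. \<bar>y - x0\<bar> < e \<longrightarrow> u y \<le> \<phi> y)
        \<longrightarrow> a x0 * \<phi>2 x0 + H x0 (\<phi>1 x0) \<ge> c)"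

definition visc_sol :: "(real \<Rightarrow> real) \<Rightarrow> (real \<Rightarrow> real \<Rightarrow> real) \<Rightarrow> real \<Rightarrow> (real \<Rightarrow> real) \<Rightarrow> bool" where
  "visc_sol a H c u \<longleftrightarrow> visc_super a H c u \<and> visc_sub a H c u"

definition lambda0 :: "(real \<Rightarrow> real) \<Rightarrow> (real \<Rightarrow> real \<Rightarrow> real) \<Rightarrow> real" where
  "lambda0 a H = Inf {c. \<exists>u. visc_super a H c u}"

end

theory Submission
  imports Defs
begin

text \<open>
  Since the square root of \<open>a\<close> is Lipschitz, \<open>a(y) \<le> K (y - z)\<^sup>2\<close> for every zero \<open>z\<close> of \<open>a\<close>; hence
  in the time scale \<open>dx = a(x) dt\<close> every component of \<open>{a > 0}\<close> contains, close to \<open>x0\<close> and both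
  to the left and to the right of any point near \<open>x0\<close>, a window that takes arbitrarily long to
  cross. There \<open>f\<close> solves \<open>df/dt = lam - H(x, f)\<close>, an almost autonomous equation whose upper
  rest point attracts forwards and whose lower one repels. A bounded solution that is above the
  upper rest point, or strictly between the two, at some point near \<open>x0\<close> would leave every bounded
  set, respectively cross the lower rest point, when followed backwards through such a window. What
  remains to be excluded is that \<open>f\<close> is near the lower rest point, and this is what
  \<open>f \<ge> u'\<close> does: following \<open>u'\<close> forwards shows that it is asymptotically at least the lower
  root at the smaller level, which is strictly above the lower root at level \<open>lam\<close>.

  The last step is carried out on \<open>u\<close> itself, with quadratic test functions, so that only
  differentiability of \<open>u\<close> on \<open>{a > 0}\<close> is needed; it holds because \<open>u\<close> is there locally both
  semiconcave (as a supersolution) and semiconvex (as a subsolution). Case (b) is case (a) under the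
  reflection \<open>x \<mapsto> - x\<close>, \<open>p \<mapsto> - p\<close>.
\<close>

section \<open>Viscosity supersolutions tested with quadratics\<close>

lemma C2_fun_quadratic:
  "C2_fun (\<lambda>y. b + (p * y + s / 2 * y\<^sup>2)) (\<lambda>y. p + s * y) (\<lambda>_. s)"
  unfolding C2_fun_def by (auto intro!: derivative_eq_intros)

text \<open>Adding the constant that makes the quadratic touch \<open>u\<close> at \<open>z\<close>
  turns a local minimum of the difference into an admissible test from below. All later tests with
  quadratics take this form.\<close>

lemma visc_super_at_local_min:
  assumes "visc_super a H c u" "e > 0"
    and "\<And>y. \<bar>y - z\<bar> < e \<Longrightarrow> u z - (p * z + s / 2 * z\<^sup>2) \<le> u y - (p * y + s / 2 * y\<^sup>2)"
  shows "a z * s + H z (p + s * z) \<le> c"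
proof -
  define b where "b = u z - (p * z + s / 2 * z\<^sup>2)"
  have "\<exists>e>0. \<forall>y. \<bar>y - z\<bar> < e \<longrightarrow> b + (p * y + s / 2 * y\<^sup>2) \<le> u y"
  proof (intro exI[of _ e] conjI allI impI assms(2))
    fix y assume "\<bar>y - z\<bar> < e"
    then show "b + (p * y + s / 2 * y\<^sup>2) \<le> u y"
      using assms(3)[of y] by (simp add: b_def)
  qed
  moreover have "b + (p * z + s / 2 * z\<^sup>2) = u z"
    by (simp add: b_def)
  ultimately show ?thesis
    using assms(1) C2_fun_quadratic[of b p s] unfolding visc_super_def by blast
qed

text \<open>A quadratic whose slope at \<open>z\<close> exceeds \<open>L\<close> in absolute value
  outgrows \<open>u\<close> on one side of \<open>z\<close>, so the difference would drop below its
  value there. This keeps test slopes in a range where \<open>H\<close> is controlled.\<close>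

lemma slope_bound_at_local_min:
  fixes u :: "real \<Rightarrow> real"
  assumes lip: "L-lipschitz_on UNIV u" and e: "e > 0"
    and min: "\<And>y. \<bar>y - z\<bar> < e \<Longrightarrow> u z - (p * z + s / 2 * z\<^sup>2) \<le> u y - (p * y + s / 2 * y\<^sup>2)"
  shows "\<bar>p + s * z\<bar> \<le> L"
proof -
  have u: "\<bar>u x - u y\<bar> \<le> L * \<bar>x - y\<bar>" for x y
    using lipschitz_onD[OF lip, of x y] by (simp add: dist_real_def)
  have False if "p + s * z > L"
  proof -
    have "((\<lambda>y. (p * y + s / 2 * y\<^sup>2) - L * y) has_real_derivative (p + s * z - L)) (at z)"
      by (auto intro!: derivative_eq_intros)
    moreover have "p + s * z - L > 0" using that by simp
    ultimately obtain d where "d > 0"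
      and d: "\<And>h. 0 < h \<Longrightarrow> h < d \<Longrightarrow> (p * z + s / 2 * z\<^sup>2) - L * z
              < (p * (z + h) + s / 2 * (z + h)\<^sup>2) - L * (z + h)"
      by (blast dest: DERIV_pos_inc_right)
    define h where "h = min d e / 2"
    have h: "0 < h" "h < d" "h < e" using e \<open>d > 0\<close> by (auto simp: h_def)
    show False
      using d[OF h(1,2)] min[of "z + h"] u[of "z + h" z] h by (simp add: algebra_simps)
  qed
  moreover have False if "p + s * z < - L"
  proof -
    have "((\<lambda>y. (p * y + s / 2 * y\<^sup>2) + L * y) has_real_derivative (p + s * z + L)) (at z)"
      by (auto intro!: derivative_eq_intros)
    moreover have "p + s * z + L < 0" using that by simp
    ultimately obtain d where "d > 0"
      and d: "\<And>h. 0 < h \<Longrightarrow> h < d \<Longrightarrow> (p * z + s / 2 * z\<^sup>2) + L * z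
              < (p * (z - h) + s / 2 * (z - h)\<^sup>2) + L * (z - h)"
      by (blast dest: DERIV_neg_dec_left)
    define h where "h = min d e / 2"
    have h: "0 < h" "h < d" "h < e" using e \<open>d > 0\<close> by (auto simp: h_def)
    show False
      using d[OF h(1,2)] min[of "z - h"] u[of "z - h" z] h by (simp add: algebra_simps)
  qed
  ultimately show ?thesis by fastforce
qed

lemma interior_local_min:
  fixes v :: "real \<Rightarrow> real"
  assumes "continuous_on {l..r} v" "l \<le> r"
    and "\<exists>t\<in>{l..r}. v t < v l" "\<exists>t\<in>{l..r}. v t < v r"
  obtains z e where "l < z" "z < r" "e > 0" "\<And>y. \<bar>y - z\<bar> < e \<Longrightarrow> v z \<le> v y"
proof -
  obtain z where z: "z \<in> {l..r}" "\<And>y. y \<in> {l..r} \<Longrightarrow> v z \<le> v y"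
    using continuous_attains_inf[of "{l..r}" v] assms(1,2) by auto
  have "z \<noteq> l" "z \<noteq> r"
    using z(2) assms(3,4) by (auto simp: not_le[symmetric])
  then have "l < z" "z < r"
    using z(1) by auto
  moreover have "v z \<le> v y" if "\<bar>y - z\<bar> < min (z - l) (r - z)" for y
    using that by (intro z(2)) auto
  ultimately show ?thesis
    by (intro that[of z "min (z - l) (r - z)"]) auto
qed

section \<open>Differentiability of solutions where the diffusion is positive\<close>

text \<open>If the function rose above one of its chords, \<open>u\<close> minus a quadratic with
  second derivative \<open>k\<close> would have an interior minimum. Testing there makes
  \<open>a z * k\<close> plus a value of \<open>H\<close> that is at least \<open>- B\<close>
  bounded by \<open>c\<close>, against \<open>k * m > c + B\<close>.\<close>

lemma visc_super_imp_semiconcave: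
  assumes super: "visc_super a H c u" and lip: "L-lipschitz_on UNIV u"
    and H: "\<And>z p. \<bar>p\<bar> \<le> L \<Longrightarrow> - B \<le> H z p"
    and a: "\<And>z. z \<in> {s..t} \<Longrightarrow> m \<le> a z" and k: "k \<ge> 0" "k * m > c + B"
  shows "convex_on {s..t} (\<lambda>y. k / 2 * y\<^sup>2 - u y)"
proof (rule convex_on_linorderI)
  let ?w = "\<lambda>y. k / 2 * y\<^sup>2 - u y"
  fix \<tau> x y :: real
  assume \<tau>: "0 < \<tau>" "\<tau> < 1" and xy: "x \<in> {s..t}" "y \<in> {s..t}" "x < y"
  define x' where "x' = (1 - \<tau>) * x + \<tau> * y"
  have x': "x' - x = \<tau> * (y - x)" "y - x' = (1 - \<tau>) * (y - x)"
    by (simp_all add: x'_def algebra_simps)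
  have "0 < x' - x" "0 < y - x'"
    unfolding x' using \<tau> xy by simp_all
  then have x'_in: "x' \<in> {x..y}" by simp
  \<comment> \<open>\<open>p\<close> is the chord slope of \<open>- ?w\<close>; hence
    \<open>v\<close>, which is \<open>- ?w\<close> minus the linear function of that slope, takes
    equal values at \<open>x\<close> and \<open>y\<close>.\<close>
  define p where "p = (?w x - ?w y) / (y - x)"
  define v where "v = (\<lambda>y. u y - (p * y + k / 2 * y\<^sup>2))"
  have p: "p * (y - x) = ?w x - ?w y" using xy by (simp add: p_def)
  have False if "?w x' > (1 - \<tau>) * ?w x + \<tau> * ?w y"
  proof -
    have vw: "v = (\<lambda>y. - ?w y - p * y)" by (auto simp: v_def algebra_simps)
    have "v x' - v x = ?w x - ?w x' - p * (x' - x)"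
      unfolding vw by (simp add: right_diff_distrib)
    also have "p * (x' - x) = \<tau> * (?w x - ?w y)"
      unfolding x' p[symmetric] by simp
    also have "?w x - ?w x' - \<tau> * (?w x - ?w y) = (1 - \<tau>) * ?w x + \<tau> * ?w y - ?w x'"
      by (simp add: left_diff_distrib right_diff_distrib)
    finally have 1: "v x' < v x" using that by linarith
    have 2: "v x = v y"
      unfolding vw using p by (simp add: right_diff_distrib)
    have "continuous_on UNIV u"
      using lip by (rule lipschitz_on_continuous_on)
    then have "continuous_on {x..y} v"
      unfolding v_def by (auto intro!: continuous_intros intro: continuous_on_subset)
    then obtain z e where z: "x < z" "z < y" "e > 0" "\<And>y. \<bar>y - z\<bar> < e \<Longrightarrow> v z \<le> v y"
      by (rule interior_local_min) (use 1 2 x'_in xy in auto)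
    have "a z * k + H z (p + k * z) \<le> c"
      using visc_super_at_local_min[OF super z(3)] z(4) unfolding v_def by blast
    moreover have "- B \<le> H z (p + k * z)"
      using slope_bound_at_local_min[OF lip z(3)] z(4) H unfolding v_def by blast
    moreover have "m * k \<le> a z * k"
      using a[of z] z xy k by (intro mult_right_mono) auto
    ultimately show False using k(2) by (simp add: mult.commute)
  qed
  then show "?w ((1 - \<tau>) *\<^sub>R x + \<tau> *\<^sub>R y) \<le> (1 - \<tau>) * ?w x + \<tau> * ?w y"
    unfolding x'_def by fastforce
qed simp

text \<open>Semiconvexity of a subsolution is semiconcavity of \<open>- u\<close>, and this change
  of sign makes the supersolution result applicable to it.\<close>

lemma visc_sub_imp_visc_super_uminus:
  assumes "visc_sub a H c u"
  shows "visc_super a (\<lambda>x p. - H x (- p)) (- c) (\<lambda>x. - u x)"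
  unfolding visc_super_def
proof (intro conjI allI impI)
  show "continuous_on UNIV (\<lambda>x. - u x)"
    using assms by (auto simp: visc_sub_def intro!: continuous_intros)
  fix \<phi> \<phi>1 \<phi>2 x0
  assume *: "C2_fun \<phi> \<phi>1 \<phi>2 \<and> \<phi> x0 = - u x0 \<and> (\<exists>e>0. \<forall>y. \<bar>y - x0\<bar> < e \<longrightarrow> \<phi> y \<le> - u y)"
  have "C2_fun (\<lambda>y. - \<phi> y) (\<lambda>y. - \<phi>1 y) (\<lambda>y. - \<phi>2 y)"
    using * by (auto simp: C2_fun_def intro!: derivative_intros continuous_intros)
  moreover have "\<exists>e>0. \<forall>y. \<bar>y - x0\<bar> < e \<longrightarrow> u y \<le> - \<phi> y"
    using * by (metis le_minus_iff)
  moreover have "- \<phi> x0 = u x0" using * by simp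
  ultimately have "c \<le> a x0 * (- \<phi>2 x0) + H x0 (- \<phi>1 x0)"
    using assms unfolding visc_sub_def by blast
  then show "a x0 * \<phi>2 x0 + - H x0 (- \<phi>1 x0) \<le> - c" by simp
qed

lemma convex_on_slope_mono:
  fixes w :: "real \<Rightarrow> real"
  assumes w: "convex_on {s..t} w" and x: "x \<in> {s..t}"
    and y: "y1 \<in> {s..t}" "y2 \<in> {s..t}" "y1 \<noteq> x" "y2 \<noteq> x" "y1 \<le> y2"
  shows "(w y1 - w x) / (y1 - x) \<le> (w y2 - w x) / (y2 - x)"
proof -
  have flip: "(A - B) / (C - D) = (B - A) / (D - C)" for A B C D :: real
    by (metis minus_diff_eq minus_divide_divide)
  consider "y1 = y2" | "y1 < y2" "y2 < x" | "y1 < x" "x < y2" | "x < y1" "y1 < y2"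
    using y by linarith
  then show ?thesis
  proof cases
    case 2
    then show ?thesis using convex_on_slope_le(2)[OF w y(1) x, of y2] by simp
  next
    case 3
    then show ?thesis
      using convex_on_slope_le[OF w y(1,2), of x] by (simp add: flip[of "w y2"])
  next
    case 4
    then show ?thesis
      using convex_on_slope_le(1)[OF w x y(2), of y1] by (simp add: flip[of "w x"])
  qed simp
qed

text \<open>The difference quotients of the two convex functions are monotone and add up to
  an affine function, so each of them is Lipschitz in the increment.\<close>

lemma semiconcave_semiconvex_imp_differentiable:
  fixes u :: "real \<Rightarrow> real"
  assumes x: "s < x" "x < t"
    and c1: "convex_on {s..t} (\<lambda>y. k / 2 * y\<^sup>2 - u y)"
    and c2: "convex_on {s..t} (\<lambda>y. k / 2 * y\<^sup>2 + u y)"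
  shows "\<exists>D. (u has_real_derivative D) (at x)"
proof -
  let ?w1 = "\<lambda>y. k / 2 * y\<^sup>2 - u y" and ?w2 = "\<lambda>y. k / 2 * y\<^sup>2 + u y"
  define S1 where "S1 = (\<lambda>y. (?w1 y - ?w1 x) / (y - x))"
  define S2 where "S2 = (\<lambda>y. (?w2 y - ?w2 x) / (y - x))"
  define X where "X = {s..t} - {x}"
  have sum: "S1 y + S2 y = k * (y + x)" if "y \<noteq> x" for y
  proof -
    have "S1 y + S2 y = (k * (y + x) * (y - x)) / (y - x)"
      unfolding S1_def S2_def add_divide_distrib[symmetric]
      by (simp add: algebra_simps power2_eq_square)
    then show ?thesis using that by simp
  qed
  have mono: "S1 y \<le> S1 y'" "S2 y \<le> S2 y'" if "y \<in> X" "y' \<in> X" "y \<le> y'" for y y'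
    using convex_on_slope_mono[OF c1, of x y y'] convex_on_slope_mono[OF c2, of x y y'] that x
    unfolding S1_def S2_def X_def by auto
  have step: "\<bar>S2 y - S2 y'\<bar> \<le> k * \<bar>y - y'\<bar>" if "y \<in> X" "y' \<in> X" "y \<le> y'" for y y'
    using mono[OF that] sum[of y] sum[of y'] that by (simp add: X_def algebra_simps)
  have lipS: "\<bar>S2 y - S2 y'\<bar> \<le> k * \<bar>y - y'\<bar>" if "y \<in> X" "y' \<in> X" for y y'
    using step[OF that] step[OF that(2,1)] by (metis abs_minus_commute linear)
  have "\<bar>k\<bar>-lipschitz_on X S2"
  proof (rule lipschitz_onI)
    fix y y' assume "y \<in> X" "y' \<in> X"
    then have "\<bar>S2 y - S2 y'\<bar> \<le> k * \<bar>y - y'\<bar>" by (rule lipS)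
    also have "\<dots> \<le> \<bar>k\<bar> * \<bar>y - y'\<bar>" by (intro mult_right_mono) auto
    finally show "dist (S2 y) (S2 y') \<le> \<bar>k\<bar> * dist y y'" by (simp add: dist_real_def)
  qed simp
  then have "uniformly_continuous_on X S2"
    by (rule lipschitz_on_uniformly_continuous)
  moreover have "x \<in> closure X"
  proof -
    have "x islimpt {s..t}" using x by (intro interior_limit_point) simp
    then show ?thesis
      unfolding X_def closure_def by (simp add: islimpt_def)  blast
  qed
  \<comment> \<open>A Lipschitz function has a limit at each point of the closure of its domain. The
    limit of the quotients \<open>S2\<close> at \<open>x\<close> is the derivative of
    \<open>?w2\<close>.\<close>
  ultimately obtain d where "(S2 \<longlongrightarrow> d) (at x within X)"
    using uniformly_continuous_on_extension_at_closure by blast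
  then have "(S2 \<longlongrightarrow> d) (at x within {s..t})"
    unfolding X_def by (simp add: at_within_def)
  then have "(S2 \<longlongrightarrow> d) (at x)"
    using x by (simp add: at_within_Icc_at)
  then have "(?w2 has_real_derivative d) (at x)"
    unfolding has_field_derivative_iff S2_def .
  moreover have "((\<lambda>y. k / 2 * y\<^sup>2) has_real_derivative k * x) (at x)"
    by (auto intro!: derivative_eq_intros)
  ultimately have "((\<lambda>y. ?w2 y - k / 2 * y\<^sup>2) has_real_derivative d - k * x) (at x)"
    by (rule DERIV_diff)
  then show ?thesis by auto
qed

text \<open>By continuity the diffusion stays above \<open>a x / 2\<close> near \<open>x\<close>, so
  the semiconcavity result applies to \<open>u\<close> and, through the subsolution property, to
  \<open>- u\<close>.\<close>

lemma visc_sol_differentiable: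
  assumes sol: "visc_sol a H c u" and lip: "L-lipschitz_on UNIV u"
    and H: "\<And>z p. \<bar>p\<bar> \<le> L \<Longrightarrow> \<bar>H z p\<bar> \<le> B"
    and a: "continuous_on UNIV a" "a x > 0"
  shows "\<exists>D. (u has_real_derivative D) (at x)"
proof -
  have "open {y. a x / 2 < a y}"
    using a(1) by (intro open_Collect_less) auto
  moreover have "x \<in> {y. a x / 2 < a y}" using a(2) by simp
  ultimately obtain e where e: "e > 0" "cball x e \<subseteq> {y. a x / 2 < a y}"
    by (meson open_contains_cball)
  then have near: "a x / 2 \<le> a z" if "z \<in> {x - e..x + e}" for z
    using that by (fastforce simp: cball_eq_atLeastAtMost)
  have "B \<ge> 0" using H[of 0 x] lipschitz_on_nonneg[OF lip] by force
  \<comment> \<open>The absolute value serves both applications: \<open>k * (a x / 2)\<close>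
    exceeds \<open>c + B\<close> as well as \<open>- c + B\<close>.\<close>
  define k where "k = (\<bar>c\<bar> + B + 1) / (a x / 2)"
  have k: "k \<ge> 0" "k * (a x / 2) = \<bar>c\<bar> + B + 1"
    using a \<open>B \<ge> 0\<close> by (auto simp: k_def)
  have "convex_on {x - e..x + e} (\<lambda>y. k / 2 * y\<^sup>2 - u y)"
  proof (rule visc_super_imp_semiconcave[where L = L and B = B and a = a and H = H
          and m = "a x / 2" and c = c])
    show "visc_super a H c u" using sol by (simp add: visc_sol_def)
    show "- B \<le> H z p" if "\<bar>p\<bar> \<le> L" for z p
      using H[OF that, of z] by simp
  qed (use near k lip in auto)
  moreover have "convex_on {x - e..x + e} (\<lambda>y. k / 2 * y\<^sup>2 - (- u y))"
  proof (rule visc_super_imp_semiconcave[where L = L and B = B and a = a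
          and H = "\<lambda>x p. - H x (- p)" and m = "a x / 2" and c = "- c"])
    show "visc_super a (\<lambda>x p. - H x (- p)) (- c) (\<lambda>x. - u x)"
      using sol by (intro visc_sub_imp_visc_super_uminus) (simp add: visc_sol_def)
    show "L-lipschitz_on UNIV (\<lambda>x. - u x)" using lip by simp
    show "- B \<le> - H z (- p)" if "\<bar>p\<bar> \<le> L" for z p
      using H[of "- p" z] that by simp
  qed (use near k in auto)
  ultimately show ?thesis
    using e(1) by (intro semiconcave_semiconvex_imp_differentiable[of "x - e" x "x + e" k u]) auto
qed

section \<open>Comparison of slopes\<close>

text \<open>If the slope of \<open>u\<close> started below the line \<open>p + s * y\<close> and
  ended above it, \<open>u\<close> minus the corresponding parabola would decrease after
  \<open>l\<close> and increase before \<open>t\<close>. It would then have an interior minimum,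
  where the test contradicts \<open>strict\<close>. No differentiability of \<open>u\<close> between
  the endpoints enters.\<close>

lemma visc_super_slope_le:
  assumes super: "visc_super a H c u" and lt: "l < t"
    and Dl: "(u has_real_derivative Dl) (at l)" "Dl < p + s * l"
    and Dt: "(u has_real_derivative Dt) (at t)"
    and strict: "\<And>z. l < z \<Longrightarrow> z < t \<Longrightarrow> a z * s + H z (p + s * z) > c"
  shows "Dt \<le> p + s * t"
proof (rule ccontr)
  assume "\<not> Dt \<le> p + s * t"
  define v where "v = (\<lambda>y. u y - (p * y + s / 2 * y\<^sup>2))"
  have "(v has_real_derivative Dl - (p + s * l)) (at l)"
    unfolding v_def using Dl(1) by (auto intro!: derivative_eq_intros)
  moreover have "Dl - (p + s * l) < 0" using Dl(2) by simp
  ultimately obtain d where "d > 0" and d: "\<And>h. 0 < h \<Longrightarrow> h < d \<Longrightarrow> v (l + h) < v l"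
    by (blast dest: DERIV_neg_dec_right)
  have "(v has_real_derivative Dt - (p + s * t)) (at t)"
    unfolding v_def using Dt(1) by (auto intro!: derivative_eq_intros)
  moreover have "Dt - (p + s * t) > 0" using \<open>\<not> Dt \<le> p + s * t\<close> by simp
  ultimately obtain d' where "d' > 0" and d': "\<And>h. 0 < h \<Longrightarrow> h < d' \<Longrightarrow> v (t - h) < v t"
    by (blast dest: DERIV_pos_inc_left)
  define h where "h = min (min d d') (t - l) / 2"
  have h: "0 < h" "h < d" "h < d'" "h < t - l"
    using \<open>d > 0\<close> \<open>d' > 0\<close> lt by (auto simp: h_def min_def)
  have "continuous_on UNIV u" using super by (simp add: visc_super_def)
  then have "continuous_on {l..t} v"
    unfolding v_def by (auto intro!: continuous_intros intro: continuous_on_subset)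
  moreover have "\<exists>y\<in>{l..t}. v y < v l" using d[OF h(1,2)] h by (intro bexI[of _ "l + h"]) auto
  moreover have "\<exists>y\<in>{l..t}. v y < v t" using d'[OF h(1,3)] h by (intro bexI[of _ "t - h"]) auto
  ultimately obtain z e where z: "l < z" "z < t" "e > 0" "\<And>y. \<bar>y - z\<bar> < e \<Longrightarrow> v z \<le> v y"
    using lt by (blast intro: interior_local_min less_imp_le)
  have "a z * s + H z (p + s * z) \<le> c"
    using visc_super_at_local_min[OF super z(3)] z(4) unfolding v_def by blast
  then show False using strict[OF z(1,2)] by simp
qed

section \<open>Slow crossing near zeros of the diffusion\<close>

text \<open>The two features of the diffusion that drive the argument: \<open>quadratic\<close> is
  the Lipschitz bound on the square root read off at a zero, and the last two assumptions express
  that the components of the positivity set are bounded.\<close>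

locale degenerate_diffusion =
  fixes a :: "real \<Rightarrow> real" and K :: real
  assumes nonneg: "0 \<le> a x"
    and cont: "continuous_on UNIV a"
    and K_pos: "0 < K"
    and quadratic: "a z = 0 \<Longrightarrow> a y \<le> K * (y - z)\<^sup>2"
    and zero_right: "0 < a x \<Longrightarrow> \<exists>z>x. a z = 0"
    and zero_left: "0 < a x \<Longrightarrow> \<exists>z<x. a z = 0"
begin

lemma reflected: "degenerate_diffusion (\<lambda>x. a (- x)) K"
proof
  show "0 \<le> a (- x)" for x by (rule nonneg)
  show "continuous_on UNIV (\<lambda>x. a (- x))"
    by (intro continuous_on_compose2[OF cont] continuous_intros) auto
  show "0 < K" by (rule K_pos)
  show "a (- y) \<le> K * (y - z)\<^sup>2" if "a (- z) = 0" for y z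
    using quadratic[OF that, of "- y"] by (simp add: power2_commute)
  show "\<exists>z>x. a (- z) = 0" if "0 < a (- x)" for x
    using zero_left[OF that] by (metis minus_less_iff minus_minus)
  show "\<exists>z<x. a (- z) = 0" if "0 < a (- x)" for x
    using zero_right[OF that] by (metis less_minus_iff minus_minus)
qed

lemma next_zero:
  assumes "0 < a x"
  obtains b where "x < b" "a b = 0" "\<And>y. x \<le> y \<Longrightarrow> y < b \<Longrightarrow> 0 < a y"
proof -
  define Z where "Z = {y. a y = 0} \<inter> {x..}"
  have "closed {y. a y = 0}"
    using cont by (intro closed_Collect_eq) auto
  then have Z: "closed Z" "Z \<noteq> {}" "bdd_below Z"
    using zero_right[OF assms] by (auto simp: Z_def less_imp_le intro!: closed_Int)
  have b: "Inf Z \<in> Z" using closed_contains_Inf Z by blast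
  then have "x < Inf Z" "a (Inf Z) = 0"
    using assms by (auto simp: Z_def less_le)
  moreover have "0 < a y" if "x \<le> y" "y < Inf Z" for y
    using cInf_lower[of y Z] Z(3) that nonneg[of y] by (fastforce simp: Z_def less_le)
  ultimately show ?thesis by (rule that)
qed

text \<open>Crossing the window \<open>[l, l + h]\<close> with the time scale \<open>dx = a(x) dt\<close> takes time
  at least \<open>1 / (4 K h)\<close>.\<close>

lemma slow_window_right:
  assumes x0: "a x0 = 0" and pos: "0 < \<delta>" "0 < h0"
  obtains \<rho> where "0 < \<rho>"
    and "\<And>x. 0 < a x \<Longrightarrow> \<bar>x - x0\<bar> < \<rho> \<Longrightarrow>
      \<exists>l h. 0 < h \<and> h < h0 \<and> x \<le> l \<and>
        (\<forall>y\<in>{x..l + h}. 0 < a y \<and> \<bar>y - x0\<bar> < \<delta>) \<and> (\<forall>y\<in>{l..l + h}. a y \<le> 4 * K * h\<^sup>2)"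
proof
  show "0 < min (\<delta> / 2) h0" using pos by simp
  fix x assume ax: "0 < a x" and x: "\<bar>x - x0\<bar> < min (\<delta> / 2) h0"
  obtain b where b: "x < b" "a b = 0" "\<And>y. x \<le> y \<Longrightarrow> y < b \<Longrightarrow> 0 < a y"
    using next_zero[OF ax] by blast
  have near: "a y \<le> 4 * K * h\<^sup>2" if "a z = 0" "\<bar>y - z\<bar> \<le> 2 * h" for y z h
  proof -
    have "(y - z)\<^sup>2 \<le> (2 * h)\<^sup>2"
      using that(2) by (intro abs_le_square_iff[THEN iffD1]) simp
    then have "K * (y - z)\<^sup>2 \<le> K * (4 * h\<^sup>2)"
      using K_pos by (intro mult_left_mono) (auto simp: power_mult_distrib)
    then show ?thesis using quadratic[OF that(1), of y] by simp
  qed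
  show "\<exists>l h. 0 < h \<and> h < h0 \<and> x \<le> l \<and>
        (\<forall>y\<in>{x..l + h}. 0 < a y \<and> \<bar>y - x0\<bar> < \<delta>) \<and> (\<forall>y\<in>{l..l + h}. a y \<le> 4 * K * h\<^sup>2)"
  \<comment> \<open>The next zero \<open>b\<close> may be far from \<open>x0\<close>. If it lies
    beyond \<open>2 * x - x0\<close>, the window starts at \<open>x\<close> with length
    \<open>x - x0\<close>, and \<open>x0\<close> itself is the zero within distance
    \<open>2 * h\<close>. Otherwise \<open>b\<close> is close, and the window is
    \<open>[b - 2 * h, b - h]\<close>, measured from the zero \<open>b\<close>.\<close>
  proof (cases "x0 < x \<and> 2 * x - x0 < b")
    case True
    show ?thesis
    proof (intro exI conjI ballI)
      show "0 < x - x0" "x - x0 < h0" "x \<le> x" using True x by auto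
      show "0 < a y" if "y \<in> {x..x + (x - x0)}" for y using b(3)[of y] that True by auto
      show "\<bar>y - x0\<bar> < \<delta>" if "y \<in> {x..x + (x - x0)}" for y using that True x by auto
      show "a y \<le> 4 * K * (x - x0)\<^sup>2" if "y \<in> {x..x + (x - x0)}" for y
        using that True by (intro near[OF x0]) auto
    qed
  next
    case False
    have "b \<le> x0" if "x < x0" using b(3)[of x0] x0 that by force
    moreover have "x \<noteq> x0" using ax x0 by auto
    ultimately have bd: "b \<le> x0 \<or> b \<le> 2 * x - x0" using False by linarith
    define h where "h = min h0 (b - x) / 2"
    have h: "0 < h" "h < h0" "2 * h \<le> b - x" using b pos by (auto simp: h_def)
    show ?thesis
    proof (intro exI conjI ballI)
      show "0 < h" "h < h0" "x \<le> b - 2 * h" using h by auto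
      show "0 < a y" if "y \<in> {x..b - 2 * h + h}" for y using b(3)[of y] that h by auto
      show "\<bar>y - x0\<bar> < \<delta>" if "y \<in> {x..b - 2 * h + h}" for y
        using that h bd x by auto
      show "a y \<le> 4 * K * h\<^sup>2" if "y \<in> {b - 2 * h..b - 2 * h + h}" for y
        using that h by (intro near[OF b(2)]) auto
    qed
  qed
qed

lemma slow_window_left:
  assumes x0: "a x0 = 0" and pos: "0 < \<delta>" "0 < h0"
  obtains \<rho> where "0 < \<rho>"
    and "\<And>x. 0 < a x \<Longrightarrow> \<bar>x - x0\<bar> < \<rho> \<Longrightarrow>
      \<exists>l h. 0 < h \<and> h < h0 \<and> l \<le> x \<and>
        (\<forall>y\<in>{l - h..x}. 0 < a y \<and> \<bar>y - x0\<bar> < \<delta>) \<and> (\<forall>y\<in>{l - h..l}. a y \<le> 4 * K * h\<^sup>2)"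
proof -
  interpret R: degenerate_diffusion "\<lambda>x. a (- x)" K by (rule reflected)
  obtain \<rho> where "0 < \<rho>"
    and \<rho>: "\<And>x. 0 < a (- x) \<Longrightarrow> \<bar>x - (- x0)\<bar> < \<rho> \<Longrightarrow>
      \<exists>l h. 0 < h \<and> h < h0 \<and> x \<le> l \<and>
        (\<forall>y\<in>{x..l + h}. 0 < a (- y) \<and> \<bar>y - (- x0)\<bar> < \<delta>) \<and>
        (\<forall>y\<in>{l..l + h}. a (- y) \<le> 4 * K * h\<^sup>2)"
    by (rule R.slow_window_right[of "- x0" \<delta> h0]) (use assms in auto)
  show ?thesis
  proof (rule that[OF \<open>0 < \<rho>\<close>])
    fix x assume "0 < a x" "\<bar>x - x0\<bar> < \<rho>"
    then obtain l h where lh: "0 < h" "h < h0" "- x \<le> l"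
      "\<And>y. y \<in> {- x..l + h} \<Longrightarrow> 0 < a (- y) \<and> \<bar>y - (- x0)\<bar> < \<delta>"
      "\<And>y. y \<in> {l..l + h} \<Longrightarrow> a (- y) \<le> 4 * K * h\<^sup>2"
      using \<rho>[of "- x"] by (auto simp: abs_minus_commute)
    show "\<exists>l h. 0 < h \<and> h < h0 \<and> l \<le> x \<and>
        (\<forall>y\<in>{l - h..x}. 0 < a y \<and> \<bar>y - x0\<bar> < \<delta>) \<and> (\<forall>y\<in>{l - h..l}. a y \<le> 4 * K * h\<^sup>2)"
    proof (intro exI conjI ballI)
      show "0 < h" "h < h0" "- l \<le> x" using lh by auto
      show "0 < a y" "\<bar>y - x0\<bar> < \<delta>" if "y \<in> {- l - h..x}" for y
        using lh(4)[of "- y"] that by auto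
      show "a y \<le> 4 * K * h\<^sup>2" if "y \<in> {- l - h..- l}" for y
        using lh(5)[of "- y"] that by auto
    qed
  qed
qed

text \<open>Suppose \<open>f x < q\<close>. Backwards from \<open>x\<close>, \<open>f\<close> stays
  below \<open>q\<close> and loses at least \<open>c\<close> per unit of time in the scale
  \<open>dx = a dt\<close>. A sufficiently slow window to the left of \<open>x\<close> then forces a
  loss greater than the bound on \<open>f\<close> permits.\<close>

lemma increasing_below_imp_eventually_ge:
  assumes x0: "a x0 = 0" and pos: "0 < \<delta>" "0 < c"
    and f: "\<And>y. 0 < a y \<Longrightarrow> (f has_real_derivative f' y) (at y)"
    and M: "\<And>y. 0 < a y \<Longrightarrow> \<bar>f y\<bar> \<le> M"
    and inc: "\<And>y. 0 < a y \<Longrightarrow> \<bar>y - x0\<bar> < \<delta> \<Longrightarrow> f y < q \<Longrightarrow> c \<le> a y * f' y"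
  shows "\<exists>\<rho>>0. \<forall>x. 0 < a x \<and> \<bar>x - x0\<bar> < \<rho> \<longrightarrow> q \<le> f x"
proof -
  \<comment> \<open>For \<open>h < h0\<close> the crossing time \<open>1 / (4 * K * h)\<close>
    multiplied by \<open>c\<close> exceeds \<open>2 * (\<bar>M\<bar> + 1)\<close>, which is more
    than the oscillation of \<open>f\<close>.\<close>
  define h0 where "h0 = c / (8 * K * (\<bar>M\<bar> + 1))"
  have h0: "0 < h0" using pos K_pos by (auto simp: h0_def)
  obtain \<rho> where "0 < \<rho>"
    and \<rho>: "\<And>x. 0 < a x \<Longrightarrow> \<bar>x - x0\<bar> < \<rho> \<Longrightarrow>
      \<exists>l h. 0 < h \<and> h < h0 \<and> l \<le> x \<and>
        (\<forall>y\<in>{l - h..x}. 0 < a y \<and> \<bar>y - x0\<bar> < \<delta>) \<and> (\<forall>y\<in>{l - h..l}. a y \<le> 4 * K * h\<^sup>2)"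
    using slow_window_left[OF x0 pos(1) h0] by blast
  have "q \<le> f x" if x: "0 < a x" "\<bar>x - x0\<bar> < \<rho>" for x
  proof (rule ccontr)
    assume "\<not> q \<le> f x"
    obtain l h where h: "0 < h" "h < h0" "l \<le> x"
      and A: "\<And>y. y \<in> {l - h..x} \<Longrightarrow> 0 < a y" "\<And>y. y \<in> {l - h..x} \<Longrightarrow> \<bar>y - x0\<bar> < \<delta>"
      and small: "\<And>y. y \<in> {l - h..l} \<Longrightarrow> a y \<le> 4 * K * h\<^sup>2"
      using \<rho>[OF x] by blast
    have contf: "continuous_on {l - h..x} f"
      using f A(1) by (meson DERIV_isCont continuous_at_imp_continuous_on)
    have below: "f y < q" if y: "y \<in> {l - h..x}" for y
    proof (rule ccontr)
      assume "\<not> f y < q"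
      \<comment> \<open>\<open>Sup S\<close> is the last point of \<open>[y, x]\<close> where
        \<open>f\<close> is at least \<open>q\<close>. After it \<open>f\<close> lies below
        \<open>q\<close> and therefore increases, so it could not end below \<open>q\<close> at
        \<open>x\<close>.\<close>
      define S where "S = {y..x} \<inter> f -` {q..}"
      have "continuous_on {y..x} f"
        using contf y by (auto intro: continuous_on_subset)
      then have "closed S"
        unfolding S_def by (intro continuous_closed_preimage) auto
      moreover have "y \<in> S" "bdd_above S" using y \<open>\<not> f y < q\<close> by (auto simp: S_def)
      ultimately have "Sup S \<in> S" using closed_contains_Sup by blast
      define t where "t = Sup S"
      have t: "y \<le> t" "t \<le> x" "q \<le> f t" using \<open>Sup S \<in> S\<close> by (auto simp: S_def t_def)
      have "t < x" using t \<open>\<not> q \<le> f x\<close> by (metis less_le)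
      have after: "f z < q" if "t < z" "z \<le> x" for z
        using cSup_upper[of z S] \<open>bdd_above S\<close> that t by (fastforce simp: S_def t_def)
      obtain z where z: "t < z" "z < x" "f x - f t = (x - t) * f' z"
        using MVT2[of t x f f'] \<open>t < x\<close> f A(1) t y by (metis atLeastAtMost_iff order_trans)
      have "0 < a z" using A z t y by auto
      moreover have "c \<le> a z * f' z" using inc[of z] after[of z] A z t y by auto
      ultimately have "0 < f' z" using pos(2) by (meson less_le_trans zero_less_mult_pos)
      then have "0 < f x - f t" using z \<open>t < x\<close> by simp
      then show False using t \<open>\<not> q \<le> f x\<close> by simp
    qed
    obtain z where z: "l - h < z" "z < l" "f l - f (l - h) = h * f' z"
      using MVT2[of "l - h" l f f'] f A(1) h by auto
    have "0 < a z" "a z \<le> 4 * K * h\<^sup>2" using A z h small by auto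
    have cz: "c \<le> a z * f' z" using inc[of z] below[of z] A z h by auto
    then have "0 < f' z" using pos(2) \<open>0 < a z\<close> by (meson less_le_trans zero_less_mult_pos)
    then have "c \<le> (4 * K * h\<^sup>2) * f' z"
      using cz \<open>a z \<le> 4 * K * h\<^sup>2\<close> by (meson less_imp_le mult_right_mono order_trans)
    also have "\<dots> = (4 * K * h) * (f l - f (l - h))"
      using z by (simp add: power2_eq_square)
    also have "\<dots> \<le> (4 * K * h) * (2 * (\<bar>M\<bar> + 1))"
      using M[of l] M[of "l - h"] A h K_pos by (intro mult_left_mono) auto
    also have "\<dots> = h * (8 * K * (\<bar>M\<bar> + 1))" by simp
    also have "\<dots> < h0 * (8 * K * (\<bar>M\<bar> + 1))"
      using h K_pos by (intro mult_strict_right_mono) auto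
    also have "\<dots> = c" unfolding h0_def using K_pos by simp
    finally show False by simp
  qed
  then show ?thesis using \<open>0 < \<rho>\<close> by blast
qed

lemma decreasing_above_imp_eventually_le:
  assumes x0: "a x0 = 0" and pos: "0 < \<delta>" "0 < c"
    and f: "\<And>y. 0 < a y \<Longrightarrow> (f has_real_derivative f' y) (at y)"
    and M: "\<And>y. 0 < a y \<Longrightarrow> \<bar>f y\<bar> \<le> M"
    and dec: "\<And>y. 0 < a y \<Longrightarrow> \<bar>y - x0\<bar> < \<delta> \<Longrightarrow> q < f y \<Longrightarrow> a y * f' y \<le> - c"
  shows "\<exists>\<rho>>0. \<forall>x. 0 < a x \<and> \<bar>x - x0\<bar> < \<rho> \<longrightarrow> f x \<le> q"
proof -
  have "\<exists>\<rho>>0. \<forall>x. 0 < a x \<and> \<bar>x - x0\<bar> < \<rho> \<longrightarrow> - q \<le> - f x"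
  proof (rule increasing_below_imp_eventually_ge[OF x0 pos, where M = M])
    show "((\<lambda>x. - f x) has_real_derivative - f' y) (at y)" if "0 < a y" for y
      using f[OF that] by (rule DERIV_minus)
    show "\<bar>- f y\<bar> \<le> M" if "0 < a y" for y using M[OF that] by simp
    show "c \<le> a y * - f' y" if "0 < a y" "\<bar>y - x0\<bar> < \<delta>" "- f y < - q" for y
      using dec[of y] that by simp
  qed
  then show ?thesis by simp
qed

text \<open>Suppose \<open>D x < q\<close>. Comparison with the constant slope \<open>q\<close>
  carries \<open>D \<le> q\<close> forwards to the start of a slow window. Inside it, comparison
  with a slope falling linearly from \<open>q2\<close> to \<open>- (L + 1)\<close> pushes
  \<open>D\<close> below \<open>- L\<close>, which the Lipschitz bound forbids.\<close>

lemma visc_super_slope_eventually_ge: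
  assumes x0: "a x0 = 0" and pos: "0 < \<delta>" "0 < c" and q: "q < q2"
    and super: "visc_super a H \<mu> u" and lip: "L-lipschitz_on UNIV u"
    and diff: "\<And>y. 0 < a y \<Longrightarrow> (u has_real_derivative D y) (at y)"
    and H: "\<And>y p. \<bar>y - x0\<bar> < \<delta> \<Longrightarrow> - (L + 1) \<le> p \<Longrightarrow> p \<le> q2 \<Longrightarrow> \<mu> + c \<le> H y p"
  shows "\<exists>\<rho>>0. \<forall>x. 0 < a x \<and> \<bar>x - x0\<bar> < \<rho> \<longrightarrow> q \<le> D x"
proof -
  have D: "- L \<le> D y" if "0 < a y" for y
  proof (rule ccontr)
    assume "\<not> - L \<le> D y"
    have "((\<lambda>z. u z + L * z) has_real_derivative D y + L) (at y)"
      using diff[OF that] by (auto intro!: derivative_eq_intros)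
    moreover have "D y + L < 0" using \<open>\<not> - L \<le> D y\<close> by simp
    ultimately obtain d where "d > 0"
      and d: "\<And>h. 0 < h \<Longrightarrow> h < d \<Longrightarrow> u (y + h) + L * (y + h) < u y + L * y"
      by (blast dest: DERIV_neg_dec_right)
    obtain h where h: "0 < h" "h < d" using \<open>d > 0\<close> dense by blast
    show False
      using d[OF h] h lipschitz_onD[OF lip, of "y + h" y] by (simp add: dist_real_def algebra_simps)
  qed
  \<comment> \<open>Chosen so that the diffusion term of the steep parabola below, at most
    \<open>4 * K * h * (q2 + L + 1)\<close>, stays below the margin \<open>c\<close> when
    \<open>h < h0\<close>.\<close>
  define h0 where "h0 = c / (4 * K * (\<bar>q2 + L + 1\<bar> + 1))"
  have h0: "0 < h0" using pos K_pos by (auto simp: h0_def)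
  obtain \<rho> where "0 < \<rho>"
    and \<rho>: "\<And>x. 0 < a x \<Longrightarrow> \<bar>x - x0\<bar> < \<rho> \<Longrightarrow>
      \<exists>l h. 0 < h \<and> h < h0 \<and> x \<le> l \<and>
        (\<forall>y\<in>{x..l + h}. 0 < a y \<and> \<bar>y - x0\<bar> < \<delta>) \<and> (\<forall>y\<in>{l..l + h}. a y \<le> 4 * K * h\<^sup>2)"
    using slow_window_right[OF x0 pos(1) h0] by blast
  have "q \<le> D x" if x: "0 < a x" "\<bar>x - x0\<bar> < \<rho>" for x
  proof (rule ccontr)
    assume "\<not> q \<le> D x"
    obtain l h where h: "0 < h" "h < h0" "x \<le> l"
      and A: "\<And>y. y \<in> {x..l + h} \<Longrightarrow> 0 < a y" "\<And>y. y \<in> {x..l + h} \<Longrightarrow> \<bar>y - x0\<bar> < \<delta>"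
      and small: "\<And>y. y \<in> {l..l + h} \<Longrightarrow> a y \<le> 4 * K * h\<^sup>2"
      using \<rho>[OF x] by blast
    \<comment> \<open>This places \<open>q\<close> in the slope range of the assumption
      \<open>H\<close> and, since \<open>q < q2\<close>, makes the \<open>s\<close> below
      positive.\<close>
    have qL: "- L < q" using D[OF x(1)] \<open>\<not> q \<le> D x\<close> by simp
    have Dl: "D l \<le> q"
    proof (cases "x = l")
      case False
      have "D l \<le> q + 0 * l"
      proof (rule visc_super_slope_le[OF super, where Dl = "D x"])
        show "\<mu> < a z * 0 + H z (q + 0 * z)" if "x < z" "z < l" for z
          using H[of z q] A[of z] that h pos q qL by auto
      qed (use False h \<open>\<not> q \<le> D x\<close> A diff in auto)
      then show ?thesis by simp
    qed (use \<open>\<not> q \<le> D x\<close> in simp)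
    define s where "s = (q2 + L + 1) / h"
    have s: "s * h = q2 + L + 1" "0 < s" using h qL q by (auto simp: s_def)
    \<comment> \<open>The comparison line has slope \<open>- s\<close>; it equals \<open>q2\<close>
      at \<open>l\<close> and \<open>- (L + 1)\<close> at \<open>l + h\<close>, so its values stay
      in the range where \<open>H\<close> exceeds the level by \<open>c\<close>.\<close>
    have "D (l + h) \<le> (q2 + s * l) + (- s) * (l + h)"
    proof (rule visc_super_slope_le[OF super])
      show "l < l + h" using h by simp
      show "(u has_real_derivative D l) (at l)" "(u has_real_derivative D (l + h)) (at (l + h))"
        using diff A h by auto
      show "D l < (q2 + s * l) + (- s) * l" using Dl q by simp
      fix z assume z: "l < z" "z < l + h"
      have "s * (z - l) \<le> s * h" "0 \<le> s * (z - l)"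
        using z s(2) by (auto intro!: mult_left_mono)
      then have "\<mu> + c \<le> H z (q2 - s * (z - l))"
        using H[of z "q2 - s * (z - l)"] A(2)[of z] z h s by simp
      moreover have "q2 - s * (z - l) = (q2 + s * l) + (- s) * z" by (simp add: algebra_simps)
      moreover have "a z * s < c"
      proof -
        have "a z * s \<le> (4 * K * h\<^sup>2) * s"
          using small[of z] z s by (intro mult_right_mono) auto
        also have "\<dots> = (4 * K * (q2 + L + 1)) * h"
          unfolding s(1)[symmetric] by (simp add: power2_eq_square)
        also have "\<dots> \<le> (4 * K * (\<bar>q2 + L + 1\<bar> + 1)) * h"
          using h K_pos by (intro mult_right_mono mult_left_mono) auto
        also have "\<dots> < (4 * K * (\<bar>q2 + L + 1\<bar> + 1)) * h0"
          using h K_pos by (intro mult_strict_left_mono) auto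
        also have "\<dots> = c" unfolding h0_def using K_pos by simp
        finally show ?thesis .
      qed
      ultimately show "\<mu> < a z * - s + H z ((q2 + s * l) + (- s) * z)" by simp
    qed
    also have "\<dots> = - (L + 1)" using s(1) by (simp add: algebra_simps)
    finally show False using D[of "l + h"] A h by auto
  qed
  then show ?thesis using \<open>0 < \<rho>\<close> by blast
qed

end

section \<open>Level sets of the Hamiltonian\<close>

lemma coercive_increasing_attains:
  fixes g :: "real \<Rightarrow> real"
  assumes cont: "continuous_on UNIV g" and \<eta>: "\<eta> > 0"
    and inc: "\<And>p q. m \<le> p \<Longrightarrow> p < q \<Longrightarrow> \<eta> * (q - p) \<le> g q - g p"
    and c: "g m \<le> c"
  obtains P where "m \<le> P" "g P = c" "\<And>p. m \<le> p \<Longrightarrow> g p \<le> c \<longleftrightarrow> p \<le> P"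
    "\<And>p. m \<le> p \<Longrightarrow> g p < c \<longleftrightarrow> p < P"
proof -
  have strict: "g p < g q" if "m \<le> p" "p < q" for p q
  proof -
    have "0 < \<eta> * (q - p)" using that \<eta> by simp
    then show ?thesis using inc[OF that] by linarith
  qed
  \<comment> \<open>Growth at rate \<open>\<eta>\<close> lifts \<open>g\<close> from
    \<open>g m\<close> to at least \<open>c\<close> at this point; the extra \<open>1\<close> gives
    \<open>m < r\<close>.\<close>
  define r where "r = m + (c - g m) / \<eta> + 1"
  have "m < r" using c \<eta> by (simp add: r_def add_nonneg_pos)
  have "\<eta> * (r - m) = c - g m + \<eta>" using \<eta> by (simp add: r_def field_simps)
  then have "c \<le> g r" using inc[of m r] \<open>m < r\<close> \<eta> by simp
  then obtain P where P: "m \<le> P" "P \<le> r" "g P = c"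
    using IVT'[of g m c r] c \<open>m < r\<close> cont continuous_on_subset by fastforce
  have le: "g p \<le> c \<longleftrightarrow> p \<le> P" if "m \<le> p" for p
    using strict[of p P] strict[of P p] P that by (cases p P rule: linorder_cases) auto
  have less: "g p < c \<longleftrightarrow> p < P" if "m \<le> p" for p
    using strict[of p P] strict[of P p] P that by (cases p P rule: linorder_cases) auto
  show ?thesis using that P le less by blast
qed

text \<open>Bounds uniform in \<open>x\<close> are recorded on bounded sets of \<open>p\<close>,
  since \<open>f\<close> is bounded and \<open>u\<close> is Lipschitz. The quasiconvex shape is
  recorded at \<open>x0\<close> alone, with minimizer \<open>m\<close>; nearby points are reached
  through \<open>lipschitz_x\<close>.\<close>

locale coercive_hamiltonian =
  fixes H :: "real \<Rightarrow> real \<Rightarrow> real" and x0 m \<eta> :: real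
  assumes bounded_H: "\<exists>B. \<forall>x p. \<bar>p\<bar> \<le> M \<longrightarrow> \<bar>H x p\<bar> \<le> B"
    and lipschitz_x: "\<exists>C>0. \<forall>x y p. \<bar>p\<bar> \<le> M \<longrightarrow> \<bar>H x p - H y p\<bar> \<le> C * \<bar>x - y\<bar>"
    and cont_p: "continuous_on UNIV (H x0)"
    and \<eta>_pos: "0 < \<eta>"
    and increasing: "m \<le> p \<Longrightarrow> p < q \<Longrightarrow> \<eta> * (q - p) \<le> H x0 q - H x0 p"
    and decreasing: "p < q \<Longrightarrow> q \<le> m \<Longrightarrow> \<eta> * (q - p) \<le> H x0 p - H x0 q"
begin

lemma reflected: "coercive_hamiltonian (\<lambda>x p. H (- x) (- p)) (- x0) (- m) \<eta>"
proof
  show "\<exists>B. \<forall>x p. \<bar>p\<bar> \<le> M \<longrightarrow> \<bar>H (- x) (- p)\<bar> \<le> B" for M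
    using bounded_H[of M] by (metis abs_minus_cancel)
  show "\<exists>C>0. \<forall>x y p. \<bar>p\<bar> \<le> M \<longrightarrow> \<bar>H (- x) (- p) - H (- y) (- p)\<bar> \<le> C * \<bar>x - y\<bar>" for M
  proof -
    obtain C where "C > 0" and C: "\<And>x y p. \<bar>p\<bar> \<le> M \<Longrightarrow> \<bar>H x p - H y p\<bar> \<le> C * \<bar>x - y\<bar>"
      using lipschitz_x[of M] by blast
    have "\<bar>H (- x) (- p) - H (- y) (- p)\<bar> \<le> C * \<bar>x - y\<bar>" if "\<bar>p\<bar> \<le> M" for x y p
      using C[of "- p" "- x" "- y"] that by (simp add: abs_minus_commute)
    then show ?thesis using \<open>C > 0\<close> by blast
  qed
  show "continuous_on UNIV (\<lambda>p. H (- (- x0)) (- p))"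
    using continuous_on_compose2[OF cont_p, of UNIV uminus] by (simp add: continuous_on_minus)
  show "0 < \<eta>" by (rule \<eta>_pos)
  show "\<eta> * (q - p) \<le> H (- (- x0)) (- q) - H (- (- x0)) (- p)" if "- m \<le> p" "p < q" for p q
    using decreasing[of "- q" "- p"] that by simp
  show "\<eta> * (q - p) \<le> H (- (- x0)) (- p) - H (- (- x0)) (- q)" if "p < q" "q \<le> - m" for p q
    using increasing[of "- q" "- p"] that by simp
qed

lemma strict_mono_right:
  assumes "m \<le> p" "p < q"
  shows "H x0 p < H x0 q"
proof -
  have "0 < \<eta> * (q - p)" using assms \<eta>_pos by simp
  then show ?thesis using increasing[OF assms] by linarith
qed

lemma strict_mono_left:
  assumes "p < q" "q \<le> m"
  shows "H x0 q < H x0 p"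
proof -
  have "0 < \<eta> * (q - p)" using assms \<eta>_pos by simp
  then show ?thesis using decreasing[OF assms] by linarith
qed

lemma mono_right: "m \<le> p \<Longrightarrow> p \<le> q \<Longrightarrow> H x0 p \<le> H x0 q"
  using strict_mono_right[of p q] by (cases "p = q") auto

lemma mono_left: "p \<le> q \<Longrightarrow> q \<le> m \<Longrightarrow> H x0 q \<le> H x0 p"
  using strict_mono_left[of p q] by (cases "p = q") auto

lemma min_le: "H x0 m \<le> H x0 p"
  using mono_left[of p m] mono_right[of m p] by linarith

lemma min_unique: "H x0 p \<le> H x0 m \<Longrightarrow> p = m"
  using strict_mono_left[of p m] strict_mono_right[of m p] by (cases p m rule: linorder_cases) auto

lemma max_on_interval: "p \<in> {q..r} \<Longrightarrow> H x0 p \<le> max (H x0 q) (H x0 r)"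
  using mono_left[of q p] mono_right[of p r] by (cases "p \<le> m") (auto simp: le_max_iff_disj)

lemma hat_p_eq: "hat_p H x0 = m"
  unfolding hat_p_def using min_le min_unique by (intro the_equality) auto

lemma hat_lambda_eq: "hat_lambda H x0 = H x0 m"
  unfolding hat_lambda_def using min_le by (intro cInf_eq_minimum) auto

lemma near_x0:
  assumes "0 < e"
  obtains \<delta> where "0 < \<delta>" "\<And>y p. \<bar>y - x0\<bar> < \<delta> \<Longrightarrow> \<bar>p\<bar> \<le> M \<Longrightarrow> \<bar>H y p - H x0 p\<bar> \<le> e"
proof -
  obtain C where "C > 0" and C: "\<And>x y p. \<bar>p\<bar> \<le> M \<Longrightarrow> \<bar>H x p - H y p\<bar> \<le> C * \<bar>x - y\<bar>"
    using lipschitz_x[of M] by blast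
  show ?thesis
  proof (rule that[of "e / C"])
    show "0 < e / C" using assms \<open>C > 0\<close> by simp
    fix y p assume "\<bar>y - x0\<bar> < e / C" "\<bar>p\<bar> \<le> M"
    then have "C * \<bar>y - x0\<bar> \<le> e" using \<open>C > 0\<close> by (simp add: field_simps)
    then show "\<bar>H y p - H x0 p\<bar> \<le> e" using C[of p y x0] \<open>\<bar>p\<bar> \<le> M\<close> by linarith
  qed
qed

text \<open>The numbers \<open>N\<close> and \<open>P\<close> are the two roots at level
  \<open>c\<close>. The equivalence for \<open><\<close> places the endpoints exactly on the level;
  \<open>N = P = m\<close> is allowed and occurs when \<open>c\<close> is the minimum.\<close>

definition level_interval :: "real \<Rightarrow> real \<Rightarrow> real \<Rightarrow> bool" where
  "level_interval c N P \<longleftrightarrow> N \<le> m \<and> m \<le> P \<and>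
     (\<forall>p. H x0 p \<le> c \<longleftrightarrow> N \<le> p \<and> p \<le> P) \<and> (\<forall>p. H x0 p < c \<longleftrightarrow> N < p \<and> p < P)"

lemma level_interval_exists:
  assumes "H x0 m \<le> c"
  obtains N P where "level_interval c N P"
proof -
  interpret R: coercive_hamiltonian "\<lambda>x p. H (- x) (- p)" "- x0" "- m" \<eta> by (rule reflected)
  obtain P where P: "m \<le> P" "\<And>p. m \<le> p \<Longrightarrow> H x0 p \<le> c \<longleftrightarrow> p \<le> P"
    "\<And>p. m \<le> p \<Longrightarrow> H x0 p < c \<longleftrightarrow> p < P"
    by (rule coercive_increasing_attains[OF cont_p \<eta>_pos increasing assms]) auto
  \<comment> \<open>The lower root is minus the upper root of the reflected Hamiltonian, whose
    increasing branch is the decreasing branch of \<open>H x0\<close>.\<close>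
  obtain N where N: "- m \<le> N" "\<And>p. - m \<le> p \<Longrightarrow> H x0 (- p) \<le> c \<longleftrightarrow> p \<le> N"
    "\<And>p. - m \<le> p \<Longrightarrow> H x0 (- p) < c \<longleftrightarrow> p < N"
    by (rule coercive_increasing_attains[OF R.cont_p \<eta>_pos R.increasing, where c = c])
      (use assms in auto)
  have "H x0 p \<le> c \<longleftrightarrow> - N \<le> p \<and> p \<le> P" for p
    using P(1) P(2)[of p] N(1) N(2)[of "- p"] by (cases "m \<le> p") auto
  moreover have "H x0 p < c \<longleftrightarrow> - N < p \<and> p < P" for p
    using P(1) P(2,3)[of p] N(1) N(2,3)[of "- p"] P(3)[of m] N(3)[of "- m"]
    by (cases p m rule: linorder_cases) auto
  ultimately have "level_interval c (- N) P"
    using P(1) N(1) by (auto simp: level_interval_def)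
  then show ?thesis by (rule that)
qed

lemma p_plus_eq: "level_interval c N P \<Longrightarrow> p_plus H c x0 = P"
  unfolding p_plus_def level_interval_def by (intro cSup_eq_maximum) auto

lemma p_minus_eq: "level_interval c N P \<Longrightarrow> p_minus H c x0 = N"
  unfolding p_minus_def level_interval_def by (intro cInf_eq_minimum) auto

lemma level_interval_strict_mono:
  assumes "level_interval c N P" "level_interval c' N' P'" "c < c'"
  shows "N' < N" "P < P'"
proof -
  have "H x0 N \<le> c" "H x0 P \<le> c"
    using assms(1) by (auto simp: level_interval_def)
  then have "H x0 N < c'" "H x0 P < c'" using assms(3) by auto
  then show "N' < N" "P < P'" using assms(2) by (auto simp: level_interval_def)
qed

end

section \<open>The limit at a degenerate point\<close>

locale degenerate_equation =
  degenerate_diffusion a K + coercive_hamiltonian H x0 m \<eta>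
  for a K H x0 m \<eta> +
  assumes x0_zero: "a x0 = 0"
begin

lemma reflected_equation:
  "degenerate_equation (\<lambda>x. a (- x)) K (\<lambda>x p. H (- x) (- p)) (- x0) (- m) \<eta>"
proof -
  interpret D: degenerate_diffusion "\<lambda>x. a (- x)" K
    by (rule degenerate_diffusion.reflected) unfold_locales
  interpret C: coercive_hamiltonian "\<lambda>x p. H (- x) (- p)" "- x0" "- m" \<eta>
    by (rule coercive_hamiltonian.reflected) unfold_locales
  show ?thesis by unfold_locales (simp add: x0_zero)
qed

text \<open>Test from below with the parabola \<open>- n (y - x0)\<^sup>2\<close>: the contact point is within
  \<open>L / n\<close> of \<open>x0\<close>, where the diffusion term is of order \<open>n \<sqdot> (L / n)\<^sup>2\<close>.\<close>

lemma visc_super_imp_min_le: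
  assumes super: "visc_super a H \<mu> u" and lip: "L-lipschitz_on UNIV u"
  shows "H x0 m \<le> \<mu>"
proof (rule field_le_epsilon)
  fix e :: real assume e: "0 < e"
  have L: "0 \<le> L" using lip by (rule lipschitz_on_nonneg)
  obtain \<delta> where \<delta>: "0 < \<delta>" "\<And>y p. \<bar>y - x0\<bar> < \<delta> \<Longrightarrow> \<bar>p\<bar> \<le> L \<Longrightarrow> \<bar>H y p - H x0 p\<bar> \<le> e / 2"
    using near_x0[of "e / 2" L] e by (metis half_gt_zero)
  \<comment> \<open>The three entries place the contact point within distance \<open>1\<close> of
    \<open>x0\<close>, place it within \<open>\<delta>\<close> of \<open>x0\<close>, and make the
    diffusion term at most \<open>e / 2\<close>.\<close>
  define n where "n = max (L + 1) (max ((L + 1) / \<delta>) (4 * K * L\<^sup>2 / e))"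
  have n: "L < n" "L / \<delta> < n" "4 * K * L\<^sup>2 / e \<le> n" "0 < n"
    using L \<delta>(1) by (auto simp: n_def less_max_iff_disj divide_strict_right_mono)
  define v where "v = (\<lambda>y. u y - (2 * n * x0 * y + (- 2 * n) / 2 * y\<^sup>2))"
  have v: "v y = u y + n * (y - x0)\<^sup>2 - n * x0\<^sup>2" for y
    by (simp add: v_def power2_eq_square algebra_simps)
  have cu: "continuous_on UNIV u" using lip by (rule lipschitz_on_continuous_on)
  have "continuous_on {x0 - 1..x0 + 1} v"
    unfolding v_def using cu by (auto intro!: continuous_intros intro: continuous_on_subset)
  then obtain z where z: "z \<in> {x0 - 1..x0 + 1}" "\<And>y. y \<in> {x0 - 1..x0 + 1} \<Longrightarrow> v z \<le> v y"
    using continuous_attains_inf[of "{x0 - 1..x0 + 1}" v] by auto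
  \<comment> \<open>Comparing the minimum with the value at \<open>x0\<close> bounds the parabola by
    the Lipschitz variation of \<open>u\<close>, hence
    \<open>\<bar>z - x0\<bar> \<le> L / n\<close>.\<close>
  have "n * (z - x0)\<^sup>2 \<le> u x0 - u z" using z(2)[of x0] by (simp add: v)
  also have "\<dots> \<le> L * \<bar>z - x0\<bar>"
    using lipschitz_onD[OF lip, of x0 z] by (simp add: dist_real_def abs_minus_commute)
  finally have "(n * \<bar>z - x0\<bar>) * \<bar>z - x0\<bar> \<le> L * \<bar>z - x0\<bar>"
    by (simp add: power2_eq_square mult.assoc)
  then have nz: "n * \<bar>z - x0\<bar> \<le> L" using L by (cases "z = x0") auto
  then have zn: "\<bar>z - x0\<bar> \<le> L / n" using n by (simp add: field_simps)
  have "L / n < 1" "L / n < \<delta>" using n \<delta>(1) by (auto simp: field_simps)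
  then have "\<bar>z - x0\<bar> < 1" "\<bar>z - x0\<bar> < \<delta>" using zn by auto
  then have e': "0 < 1 - \<bar>z - x0\<bar>" by simp
  have min: "v z \<le> v y" if "\<bar>y - z\<bar> < 1 - \<bar>z - x0\<bar>" for y
    using that by (intro z(2)) auto
  let ?p = "2 * n * x0 + (- 2 * n) * z"
  have "\<bar>?p\<bar> \<le> L"
    using slope_bound_at_local_min[OF lip e'] min unfolding v_def by blast
  then have test: "H x0 ?p - e / 2 \<le> H z ?p"
    using \<delta>(2)[OF \<open>\<bar>z - x0\<bar> < \<delta>\<close>, of ?p] unfolding abs_le_iff by linarith
  have "a z * (- 2 * n) + H z ?p \<le> \<mu>"
    using visc_super_at_local_min[OF super e'] min unfolding v_def by blast
  then have "H z ?p \<le> \<mu> + 2 * n * a z" by (simp add: mult.commute)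
  moreover have "2 * n * a z \<le> e / 2"
  proof -
    have "2 * n * a z \<le> 2 * n * (K * (z - x0)\<^sup>2)"
      using quadratic[OF x0_zero, of z] n by (intro mult_left_mono) auto
    also have "(z - x0)\<^sup>2 \<le> (L / n)\<^sup>2"
      using zn by (metis abs_ge_zero power2_abs power_mono)
    then have "2 * n * (K * (z - x0)\<^sup>2) \<le> 2 * n * (K * (L / n)\<^sup>2)"
      using n K_pos by (intro mult_left_mono) auto
    also have "\<dots> = 2 * K * L\<^sup>2 / n" using n by (simp add: power2_eq_square field_simps)
    also have "\<dots> \<le> e / 2" using n(3,4) e by (simp add: field_simps)
    finally show ?thesis .
  qed
  ultimately show "H x0 m \<le> \<mu> + e"
    using test min_le[of ?p] field_sum_of_halves[of e] by linarith
qed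

text \<open>The function \<open>u\<close> supplies a barrier \<open>q0 > N\<close> below
  \<open>f\<close> near \<open>x0\<close>. From there to any \<open>q < P\<close> the Hamiltonian
  lies below \<open>lam\<close>, so \<open>f\<close> increases in time; above \<open>P\<close> it
  decreases. The two monotonicity lemmas then squeeze \<open>f\<close> towards
  \<open>P\<close>.\<close>

lemma tendsto_upper_root:
  assumes \<mu>: "level_interval \<mu> N\<^sub>0 P\<^sub>0" and \<lambda>: "level_interval lam N P" and less: "\<mu> < lam"
    and f: "\<And>y. 0 < a y \<Longrightarrow> (f has_real_derivative f' y) (at y)"
    and eq: "\<And>y. 0 < a y \<Longrightarrow> a y * f' y + H y (f y) = lam"
    and M: "\<And>y. 0 < a y \<Longrightarrow> \<bar>f y\<bar> \<le> M"
    and super: "visc_super a H \<mu> u" and lip: "L-lipschitz_on UNIV u"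
    and diff: "\<And>y. 0 < a y \<Longrightarrow> (u has_real_derivative D y) (at y)"
    and ge: "\<And>y. 0 < a y \<Longrightarrow> D y \<le> f y"
  shows "(f \<longlongrightarrow> P) (at x0 within {y. a y > 0})"
proof -
  have ev: "eventually Q (at x0 within {y. a y > 0})"
    if "\<exists>\<rho>>0. \<forall>x. 0 < a x \<and> \<bar>x - x0\<bar> < \<rho> \<longrightarrow> Q x" for Q
    using that unfolding eventually_at dist_real_def by (metis mem_Collect_eq)
  have N: "N < N\<^sub>0" "P\<^sub>0 < P" using level_interval_strict_mono[OF \<mu> \<lambda> less] .
  \<comment> \<open>The strict gap between the lower roots at levels \<open>lam\<close> and
    \<open>\<mu>\<close> leaves room for two values: \<open>q0\<close> is the barrier obtained for
    \<open>f\<close>, and \<open>q2\<close> is the slightly larger slope that its comparison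
    argument starts from.\<close>
  obtain q0 where q0: "N < q0" "q0 < N\<^sub>0" using dense[OF N(1)] by blast
  obtain q2 where q2: "q0 < q2" "q2 < N\<^sub>0" using dense[OF q0(2)] by blast
  have "q0 < P" using q0 N \<mu> by (auto simp: level_interval_def)
  have "H x0 q2 > \<mu>" "q2 \<le> m" using \<mu> q2 by (auto simp: level_interval_def not_le[symmetric])
  define c where "c = (H x0 q2 - \<mu>) / 2"
  have c: "c > 0" "H x0 q2 = \<mu> + 2 * c" using \<open>H x0 q2 > \<mu>\<close> by (auto simp: c_def field_simps)
  obtain \<delta> where \<delta>: "0 < \<delta>"
    "\<And>y p. \<bar>y - x0\<bar> < \<delta> \<Longrightarrow> \<bar>p\<bar> \<le> L + 1 + \<bar>q2\<bar> \<Longrightarrow> \<bar>H y p - H x0 p\<bar> \<le> c"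
    using near_x0[OF c(1), of "L + 1 + \<bar>q2\<bar>"] by blast
  have "\<exists>\<rho>>0. \<forall>x. 0 < a x \<and> \<bar>x - x0\<bar> < \<rho> \<longrightarrow> q0 \<le> D x"
  proof (rule visc_super_slope_eventually_ge[OF x0_zero \<delta>(1) c(1) q2(1) super lip diff])
    fix y p assume "\<bar>y - x0\<bar> < \<delta>" "- (L + 1) \<le> p" "p \<le> q2"
    then have "\<bar>H y p - H x0 p\<bar> \<le> c"
      using lipschitz_on_nonneg[OF lip] by (intro \<delta>(2)) auto
    then show "\<mu> + c \<le> H y p"
      using mono_left[of p q2] \<open>p \<le> q2\<close> \<open>q2 \<le> m\<close> c(2) by linarith
  qed
  then obtain \<rho> where \<rho>: "\<rho> > 0" "\<And>x. 0 < a x \<Longrightarrow> \<bar>x - x0\<bar> < \<rho> \<Longrightarrow> q0 \<le> f x"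
    using ge by (meson order_trans)
  have lower: "\<exists>\<rho>>0. \<forall>x. 0 < a x \<and> \<bar>x - x0\<bar> < \<rho> \<longrightarrow> q \<le> f x" if q: "q0 \<le> q" "q < P" for q
  proof -
    have "H x0 q0 < lam" "H x0 q < lam"
      using \<lambda> q q0 \<open>q0 < P\<close> by (auto simp: level_interval_def)
    \<comment> \<open>By quasiconvexity the larger endpoint value bounds \<open>H x0\<close> on all
      of \<open>[q0, q]\<close>. Half of its distance to \<open>lam\<close> is the rate of increase;
      the other half absorbs replacing \<open>x0\<close> by \<open>y\<close>.\<close>
    define d where "d = (lam - max (H x0 q0) (H x0 q)) / 2"
    have d: "d > 0" "max (H x0 q0) (H x0 q) = lam - 2 * d"
      using \<open>H x0 q0 < lam\<close> \<open>H x0 q < lam\<close> by (auto simp: d_def field_simps)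
    obtain r where r: "0 < r" "\<And>y p. \<bar>y - x0\<bar> < r \<Longrightarrow> \<bar>p\<bar> \<le> M \<Longrightarrow> \<bar>H y p - H x0 p\<bar> \<le> d"
      using near_x0[OF d(1), of M] by blast
    have "0 < min r \<rho>" using r \<rho> by simp
    then show ?thesis
    proof (rule increasing_below_imp_eventually_ge[OF x0_zero _ d(1) f M])
      fix y assume y: "0 < a y" "\<bar>y - x0\<bar> < min r \<rho>" "f y < q"
      have "H x0 (f y) \<le> lam - 2 * d"
        using max_on_interval[of "f y" q0 q] \<rho>(2)[of y] y d(2) by auto
      moreover have "\<bar>H y (f y) - H x0 (f y)\<bar> \<le> d" using r(2)[of y "f y"] M y by auto
      ultimately show "d \<le> a y * f' y" using eq[OF y(1)] by linarith
    qed
  qed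
  have upper: "\<exists>\<rho>>0. \<forall>x. 0 < a x \<and> \<bar>x - x0\<bar> < \<rho> \<longrightarrow> f x \<le> q" if q: "P < q" for q
  proof -
    have "H x0 q > lam" "m \<le> q"
      using \<lambda> q by (auto simp: level_interval_def not_le[symmetric])
    define d where "d = (H x0 q - lam) / 2"
    have d: "d > 0" "H x0 q = lam + 2 * d"
      using \<open>H x0 q > lam\<close> by (auto simp: d_def field_simps)
    obtain r where r: "0 < r" "\<And>y p. \<bar>y - x0\<bar> < r \<Longrightarrow> \<bar>p\<bar> \<le> M \<Longrightarrow> \<bar>H y p - H x0 p\<bar> \<le> d"
      using near_x0[OF d(1), of M] by blast
    show ?thesis
    proof (rule decreasing_above_imp_eventually_le[OF x0_zero r(1) d(1) f M])
      fix y assume y: "0 < a y" "\<bar>y - x0\<bar> < r" "q < f y"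
      have "H x0 (f y) \<ge> lam + 2 * d"
        using mono_right[of q "f y"] \<open>m \<le> q\<close> y d(2) by auto
      moreover have "\<bar>H y (f y) - H x0 (f y)\<bar> \<le> d" using r(2)[of y "f y"] M y by auto
      ultimately show "a y * f' y \<le> - d" using eq[OF y(1)] by linarith
    qed
  qed
  show ?thesis
  proof (rule order_tendstoI)
    fix q assume "q < P"
    then obtain q' where "max q q0 < q'" "q' < P" using dense[of "max q q0" P] \<open>q0 < P\<close> by auto
    then show "eventually (\<lambda>x. q < f x) (at x0 within {y. a y > 0})"
      using lower[of q'] by (intro ev) (auto intro: less_le_trans)
  next
    fix q assume "P < q"
    then obtain q' where "P < q'" "q' < q" using dense by blast
    then show "eventually (\<lambda>x. f x < q) (at x0 within {y. a y > 0})"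
      using upper[of q'] by (intro ev) (auto intro: le_less_trans)
  qed
qed

end

section \<open>Reflection and the lower root\<close>

text \<open>Reflecting a test function changes the sign of its first derivative and keeps the
  second, which is why the Hamiltonian is reflected in both arguments.\<close>

lemma visc_super_reflected:
  assumes "visc_super a H c u"
  shows "visc_super (\<lambda>x. a (- x)) (\<lambda>x p. H (- x) (- p)) c (\<lambda>x. u (- x))"
  unfolding visc_super_def
proof (intro conjI allI impI)
  show "continuous_on UNIV (\<lambda>x. u (- x))"
    using assms continuous_on_compose2[of UNIV u UNIV uminus]
    by (simp add: visc_super_def continuous_on_minus)
  fix \<phi> \<phi>1 \<phi>2 x0
  assume *: "C2_fun \<phi> \<phi>1 \<phi>2 \<and> \<phi> x0 = u (- x0) \<and> (\<exists>e>0. \<forall>y. \<bar>y - x0\<bar> < e \<longrightarrow> \<phi> y \<le> u (- y))"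
  have "C2_fun (\<lambda>y. \<phi> (- y)) (\<lambda>y. - \<phi>1 (- y)) (\<lambda>y. \<phi>2 (- y))"
    unfolding C2_fun_def
  proof (intro conjI allI)
    fix y
    show "((\<lambda>y. \<phi> (- y)) has_real_derivative - \<phi>1 (- y)) (at y)"
      using * by (intro DERIV_mirror[THEN iffD1]) (simp add: C2_fun_def)
    have "((\<lambda>y. \<phi>1 (- y)) has_real_derivative - \<phi>2 (- y)) (at y)"
      using * by (intro DERIV_mirror[THEN iffD1]) (simp add: C2_fun_def)
    then show "((\<lambda>y. - \<phi>1 (- y)) has_real_derivative \<phi>2 (- y)) (at y)"
      using DERIV_minus by fastforce
    show "continuous_on UNIV (\<lambda>y. \<phi>2 (- y))"
      using * continuous_on_compose2[of UNIV \<phi>2 UNIV uminus]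
      by (simp add: C2_fun_def continuous_on_minus)
  qed
  moreover have "\<exists>e>0. \<forall>y. \<bar>y - (- x0)\<bar> < e \<longrightarrow> \<phi> (- y) \<le> u y"
  proof -
    obtain e where "e > 0" and e: "\<And>y. \<bar>y - x0\<bar> < e \<Longrightarrow> \<phi> y \<le> u (- y)" using * by blast
    have "\<phi> (- y) \<le> u y" if "\<bar>y - (- x0)\<bar> < e" for y
      using e[of "- y"] that by simp
    then show ?thesis using \<open>e > 0\<close> by blast
  qed
  moreover have "\<phi> (- (- x0)) = u (- x0)" using * by simp
  ultimately have "a (- x0) * \<phi>2 (- (- x0)) + H (- x0) (- \<phi>1 (- (- x0))) \<le> c"
    using assms unfolding visc_super_def by blast
  then show "a (- x0) * \<phi>2 x0 + H (- x0) (- \<phi>1 x0) \<le> c" by simp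
qed

text \<open>For \<open>- f (- x)\<close> the derivative is \<open>f' (- x)\<close>, so the reflected
  equation holds at the same level. The level interval \<open>[N, P]\<close> becomes
  \<open>[- P, - N]\<close>, and the order between \<open>f\<close> and \<open>D\<close> is
  reversed.\<close>

lemma (in degenerate_equation) tendsto_lower_root:
  assumes \<mu>: "level_interval \<mu> N\<^sub>0 P\<^sub>0" and \<lambda>: "level_interval lam N P" and less: "\<mu> < lam"
    and f: "\<And>y. 0 < a y \<Longrightarrow> (f has_real_derivative f' y) (at y)"
    and eq: "\<And>y. 0 < a y \<Longrightarrow> a y * f' y + H y (f y) = lam"
    and M: "\<And>y. 0 < a y \<Longrightarrow> \<bar>f y\<bar> \<le> M"
    and super: "visc_super a H \<mu> u" and lip: "L-lipschitz_on UNIV u"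
    and diff: "\<And>y. 0 < a y \<Longrightarrow> (u has_real_derivative D y) (at y)"
    and le: "\<And>y. 0 < a y \<Longrightarrow> f y \<le> D y"
  shows "(f \<longlongrightarrow> N) (at x0 within {y. a y > 0})"
proof -
  interpret R: degenerate_equation "\<lambda>x. a (- x)" K "\<lambda>x p. H (- x) (- p)" "- x0" "- m" \<eta>
    by (rule reflected_equation)
  have level: "R.level_interval c (- P) (- N)" if "level_interval c N P" for c N P
  proof -
    have "N \<le> m" "m \<le> P" "\<And>p. H x0 p \<le> c \<longleftrightarrow> N \<le> p \<and> p \<le> P" "\<And>p. H x0 p < c \<longleftrightarrow> N < p \<and> p < P"
      using that by (auto simp: level_interval_def)
    then show ?thesis unfolding R.level_interval_def by auto
  qed
  have "((\<lambda>x. - f (- x)) \<longlongrightarrow> - N) (at (- x0) within {y. a (- y) > 0})"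
  proof (rule R.tendsto_upper_root[OF level[OF \<mu>] level[OF \<lambda>] less, where M = M and L = L
        and u = "\<lambda>x. u (- x)" and D = "\<lambda>x. - D (- x)" and f' = "\<lambda>x. f' (- x)"])
    show "((\<lambda>x. - f (- x)) has_real_derivative f' (- y)) (at y)" if "0 < a (- y)" for y
      using DERIV_minus[OF DERIV_mirror[THEN iffD1, OF f[OF that]]] by simp
    show "((\<lambda>x. u (- x)) has_real_derivative - D (- y)) (at y)" if "0 < a (- y)" for y
      using diff[OF that] by (rule DERIV_mirror[THEN iffD1])
    show "L-lipschitz_on UNIV (\<lambda>x. u (- x))"
    proof (rule lipschitz_onI)
      show "dist (u (- x)) (u (- y)) \<le> L * dist x y" for x y
        using lipschitz_onD[OF lip, of "- x" "- y"] by (simp add: dist_minus)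
    qed (rule lipschitz_on_nonneg[OF lip])
  qed (use eq M le visc_super_reflected[OF super] in auto)
  then have lim: "((\<lambda>x. - f (- x)) \<longlongrightarrow> - N) (at (- x0) within uminus ` {y. a y > 0})"
    by (auto elim!: tendsto_within_subset)
  \<comment> \<open>Composing with \<open>uminus\<close> carries the limit at \<open>- x0\<close>
    back to \<open>x0\<close>.\<close>
  have "filterlim uminus (at (- x0) within uminus ` {y. a y > 0}) (at x0 within {y. a y > 0})"
    unfolding filterlim_at
    by (auto simp: eventually_at_filter intro!: tendsto_eq_intros)
  from filterlim_compose[OF lim this] have "((\<lambda>x. - f x) \<longlongrightarrow> - N) (at x0 within {y. a y > 0})"
    by simp
  then show ?thesis by (simp add: tendsto_minus_cancel_left)
qed

section \<open>From the standing assumptions to the abstract setting\<close>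

text \<open>Squaring the Lipschitz estimate between \<open>y\<close> and a zero gives the quadratic
  bound; the added \<open>1\<close> makes positivity of the constant immediate. A half-line from
  \<open>x\<close> without zeros would lie in the component of \<open>x\<close> and make it
  unbounded.\<close>

lemma diffusion_ok_imp_degenerate_diffusion:
  assumes "diffusion_ok \<kappa> a"
  shows "degenerate_diffusion a (\<kappa>\<^sup>2 + 1)"
proof -
  have nonneg: "0 \<le> a x" for x using assms by (auto simp: diffusion_ok_def)
  have lip: "\<kappa>-lipschitz_on UNIV (\<lambda>x. sqrt (a x))"
    using assms by (auto simp: diffusion_ok_def)
  have bdd: "bounded (connected_component_set {y. a y > 0} x)" if "0 < a x" for x
    using assms that by (auto simp: diffusion_ok_def)
  have no_ray: "\<exists>z\<in>T. a z = 0" if "0 < a x" "x \<in> T" "connected T" "\<not> bounded T" for x T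
  proof (rule ccontr)
    assume "\<not> (\<exists>z\<in>T. a z = 0)"
    then have "T \<subseteq> {y. a y > 0}" using nonneg by (force simp: less_le)
    then have "T \<subseteq> connected_component_set {y. a y > 0} x"
      using that by (intro connected_component_maximal)
    then show False using bdd[OF that(1)] that(4) bounded_subset by blast
  qed
  have rays: "\<not> bounded {x..}" "\<not> bounded {..x}" for x :: real
  proof -
    have "\<exists>y\<ge>x. \<not> \<bar>y\<bar> \<le> B" "\<exists>y\<le>x. \<not> \<bar>y\<bar> \<le> B" for B
      by (rule exI[of _ "\<bar>x\<bar> + \<bar>B\<bar> + 1"], linarith)
        (rule exI[of _ "- (\<bar>x\<bar> + \<bar>B\<bar> + 1)"], linarith)
    then show "\<not> bounded {x..}" "\<not> bounded {..x}" unfolding bounded_iff by fastforce+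
  qed
  show ?thesis
  proof
    show "0 \<le> a x" for x by (rule nonneg)
    have "continuous_on UNIV (\<lambda>x. (sqrt (a x))\<^sup>2)"
      using lipschitz_on_continuous_on[OF lip] by (intro continuous_on_power)
    then show "continuous_on UNIV a" using nonneg by simp
    show "0 < \<kappa>\<^sup>2 + 1" by (simp add: add_nonneg_pos)
    show "a y \<le> (\<kappa>\<^sup>2 + 1) * (y - z)\<^sup>2" if "a z = 0" for y z
    proof -
      have "sqrt (a y) \<le> \<kappa> * \<bar>y - z\<bar>"
        using lipschitz_onD[OF lip, of y z] that nonneg by (simp add: dist_real_def)
      then have "(sqrt (a y))\<^sup>2 \<le> (\<kappa> * \<bar>y - z\<bar>)\<^sup>2"
        using nonneg by (intro power_mono) auto
      also have "\<dots> \<le> (\<kappa>\<^sup>2 + 1) * (y - z)\<^sup>2"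
        by (simp add: power_mult_distrib distrib_right)
      finally show ?thesis using nonneg by simp
    qed
    show "\<exists>z>x. a z = 0" if "0 < a x" for x
      using no_ray[OF that, of "{x..}"] that rays by (force simp: less_le)
    show "\<exists>z<x. a z = 0" if "0 < a x" for x
      using no_ray[OF that, of "{..x}"] that rays by (force simp: less_le)
  qed
qed

text \<open>On \<open>\<bar>p\<bar> \<le> M\<close> the growth factor is at most its value at
  \<open>M\<close>: (H1) then gives boundedness, (H3) the Lipschitz bound in \<open>x\<close>.
  Condition (H2) gives continuity in \<open>p\<close>, and \<open>m\<close> is the minimizer at
  \<open>x0\<close>.\<close>

lemma H_sqc_imp_coercive_hamiltonian:
  assumes "H_sqc \<alpha>0 \<alpha>1 \<gamma> \<eta> H"
  obtains m where "coercive_hamiltonian H x0 m \<eta>"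
proof -
  have pos: "\<alpha>0 > 0" "\<alpha>1 > 0" "\<gamma> > 2" "\<eta> > 0"
    and H1: "\<And>x p. \<alpha>0 * \<bar>p\<bar> powr \<gamma> - 1 / \<alpha>0 \<le> H x p" "\<And>x p. H x p \<le> \<alpha>1 * (\<bar>p\<bar> powr \<gamma> + 1)"
    and H2: "\<And>x p q. \<bar>H x p - H x q\<bar> \<le> \<alpha>1 * (\<bar>p\<bar> + \<bar>q\<bar> + 1) powr (\<gamma> - 1) * \<bar>p - q\<bar>"
    and H3: "\<And>x y p. \<bar>H x p - H y p\<bar> \<le> \<alpha>1 * (\<bar>p\<bar> powr \<gamma> + 1) * \<bar>x - y\<bar>"
    using assms by (auto simp: H_sqc_def)
  have "\<forall>x. \<exists>ph. (\<forall>p. p \<noteq> ph \<longrightarrow> H x ph < H x p) \<and>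
          (\<forall>p1 p2. p1 < p2 \<and> p2 \<le> ph \<longrightarrow> H x p1 - H x p2 \<ge> \<eta> * \<bar>p1 - p2\<bar>) \<and>
          (\<forall>p1 p2. p1 < p2 \<and> p1 \<ge> ph \<longrightarrow> H x p2 - H x p1 \<ge> \<eta> * \<bar>p1 - p2\<bar>)"
    using assms unfolding H_sqc_def by (elim conjE)
  then obtain m where m:
    "\<And>p1 p2. p1 < p2 \<Longrightarrow> p2 \<le> m \<Longrightarrow> H x0 p1 - H x0 p2 \<ge> \<eta> * \<bar>p1 - p2\<bar>"
    "\<And>p1 p2. p1 < p2 \<Longrightarrow> p1 \<ge> m \<Longrightarrow> H x0 p2 - H x0 p1 \<ge> \<eta> * \<bar>p1 - p2\<bar>"
    by (metis (no_types))
  have growth: "\<alpha>1 * (\<bar>p\<bar> powr \<gamma> + 1) \<le> \<alpha>1 * (M powr \<gamma> + 1)" if "\<bar>p\<bar> \<le> M" for p M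
    using that pos by (intro mult_left_mono add_right_mono powr_mono2) auto
  have "coercive_hamiltonian H x0 m \<eta>"
  proof
    show "\<exists>B. \<forall>x p. \<bar>p\<bar> \<le> M \<longrightarrow> \<bar>H x p\<bar> \<le> B" for M
    proof (intro exI allI impI)
      fix x p assume p: "\<bar>p\<bar> \<le> M"
      have "0 \<le> \<alpha>0 * \<bar>p\<bar> powr \<gamma>" "0 \<le> \<alpha>1 * (M powr \<gamma> + 1)" "0 \<le> 1 / \<alpha>0" using pos by auto
      then show "\<bar>H x p\<bar> \<le> 1 / \<alpha>0 + \<alpha>1 * (M powr \<gamma> + 1)"
        using H1[where x = x and p = p] growth[OF p] unfolding abs_le_iff by linarith
    qed
    show "\<exists>C>0. \<forall>x y p. \<bar>p\<bar> \<le> M \<longrightarrow> \<bar>H x p - H y p\<bar> \<le> C * \<bar>x - y\<bar>" for M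
    proof (intro exI conjI allI impI)
      show "0 < \<alpha>1 * (M powr \<gamma> + 1)" using pos by (simp add: add_nonneg_pos)
      fix x y p assume p: "\<bar>p\<bar> \<le> M"
      have "\<alpha>1 * (\<bar>p\<bar> powr \<gamma> + 1) * \<bar>x - y\<bar> \<le> \<alpha>1 * (M powr \<gamma> + 1) * \<bar>x - y\<bar>"
        using growth[OF p] by (rule mult_right_mono) simp
      then show "\<bar>H x p - H y p\<bar> \<le> \<alpha>1 * (M powr \<gamma> + 1) * \<bar>x - y\<bar>"
        using H3[of x p y] by linarith
    qed
    have "isCont (H x0) p" for p
    proof -
      define M where "M = \<bar>p\<bar> + 1"
      have "(\<alpha>1 * (2 * M + 1) powr (\<gamma> - 1))-lipschitz_on (ball 0 M) (H x0)"
      proof (rule lipschitz_onI)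
        fix q r :: real assume "q \<in> ball 0 M" "r \<in> ball 0 M"
        then have "(\<bar>q\<bar> + \<bar>r\<bar> + 1) powr (\<gamma> - 1) \<le> (2 * M + 1) powr (\<gamma> - 1)"
          using pos by (intro powr_mono2) (auto simp: dist_real_def)
        then have "\<alpha>1 * (\<bar>q\<bar> + \<bar>r\<bar> + 1) powr (\<gamma> - 1) * \<bar>q - r\<bar>
            \<le> \<alpha>1 * (2 * M + 1) powr (\<gamma> - 1) * \<bar>q - r\<bar>"
          using pos by (intro mult_right_mono mult_left_mono) auto
        then show "dist (H x0 q) (H x0 r) \<le> \<alpha>1 * (2 * M + 1) powr (\<gamma> - 1) * dist q r"
          using H2[of x0 q r] unfolding dist_real_def by linarith
      qed (use pos in simp)
      then have "continuous_on (ball 0 M) (H x0)" by (rule lipschitz_on_continuous_on)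
      moreover have "p \<in> ball 0 M" by (simp add: M_def dist_real_def)
      ultimately show ?thesis by (simp add: continuous_on_eq_continuous_at)
    qed
    then show "continuous_on UNIV (H x0)" by (simp add: continuous_at_imp_continuous_on)
    show "0 < \<eta>" by (rule pos)
    show "\<eta> * (q - p) \<le> H x0 q - H x0 p" if "m \<le> p" "p < q" for p q
      using m(2)[of p q] that by simp
    show "\<eta> * (q - p) \<le> H x0 p - H x0 q" if "p < q" "q \<le> m" for p q
      using m(1)[of p q] that by simp
  qed
  then show ?thesis by (rule that)
qed

theorem mainTheorem10:
  fixes a :: "real \<Rightarrow> real" and H :: "real \<Rightarrow> real \<Rightarrow> real"
    and \<kappa> \<alpha>0 \<alpha>1 \<gamma> \<eta> lam x0 :: real
    and f f' u :: "real \<Rightarrow> real"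
  assumes ha: "diffusion_ok \<kappa> a"
    and hH: "H_sqc \<alpha>0 \<alpha>1 \<gamma> \<eta> H"
    and hx0: "a x0 = 0" "x0 islimpt {x. a x > 0}"
    and hlam: "lam > lambda0 a H"
    and hf: "\<forall>x\<in>{y. a y > 0}. (f has_real_derivative f' x) (at x)"
            "continuous_on {y. a y > 0} f'"
            "\<forall>x\<in>{y. a y > 0}. a x * f' x + H x (f x) = lam"
            "bounded (f ` {y. a y > 0})"
    and hu: "\<exists>L. L-lipschitz_on UNIV u" "visc_sol a H (lambda0 a H) u"
  shows "hat_lambda H x0 \<le> lambda0 a H \<and>
    ((\<forall>x\<in>{y. a y > 0}. f x \<ge> deriv u x) \<longrightarrow>
       (f \<longlongrightarrow> p_plus H lam x0) (at x0 within {y. a y > 0}) \<and>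
       p_plus H lam x0 > p_plus H (lambda0 a H) x0 \<and>
       p_plus H (lambda0 a H) x0 \<ge> hat_p H x0) \<and>
    ((\<forall>x\<in>{y. a y > 0}. f x \<le> deriv u x) \<longrightarrow>
       (f \<longlongrightarrow> p_minus H lam x0) (at x0 within {y. a y > 0}) \<and>
       p_minus H lam x0 < p_minus H (lambda0 a H) x0 \<and>
       p_minus H (lambda0 a H) x0 \<le> hat_p H x0)"
proof -
  obtain L where lip: "L-lipschitz_on UNIV u" using hu(1) by blast
  have super: "visc_super a H (lambda0 a H) u" using hu(2) by (simp add: visc_sol_def)
  obtain m where ham: "coercive_hamiltonian H x0 m \<eta>"
    using H_sqc_imp_coercive_hamiltonian[OF hH] .
  interpret degenerate_equation a "\<kappa>\<^sup>2 + 1" H x0 m \<eta>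
    using diffusion_ok_imp_degenerate_diffusion[OF ha] ham hx0(1)
    by (simp add: degenerate_equation_def degenerate_equation_axioms_def)
  have min: "H x0 m \<le> lambda0 a H"
    using visc_super_imp_min_le[OF super lip] .
  obtain B where "\<And>x p. \<bar>p\<bar> \<le> L \<Longrightarrow> \<bar>H x p\<bar> \<le> B"
    using bounded_H[of L] by blast
  \<comment> \<open>Differentiability makes \<open>deriv u\<close> the true derivative of
    \<open>u\<close> on the positivity set, so the ordering hypotheses concern actual
    slopes.\<close>
  then have diff: "(u has_real_derivative deriv u y) (at y)" if "0 < a y" for y
    using visc_sol_differentiable[OF hu(2) lip _ cont that] DERIV_imp_deriv by metis
  obtain M where M: "\<And>y. 0 < a y \<Longrightarrow> \<bar>f y\<bar> \<le> M"
    using hf(4) by (auto simp: bounded_iff)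
  obtain N\<^sub>0 P\<^sub>0 where \<mu>: "level_interval (lambda0 a H) N\<^sub>0 P\<^sub>0"
    using level_interval_exists[OF min] .
  obtain N P where \<lambda>: "level_interval lam N P"
    using level_interval_exists[of lam] min hlam by (meson less_imp_le order_trans)
  \<comment> \<open>These identify the quantities of the statement with the roots and the minimizer
    at \<open>x0\<close>, for which the limits and strict inequalities are proved.\<close>
  note eqs = p_plus_eq[OF \<mu>] p_plus_eq[OF \<lambda>] p_minus_eq[OF \<mu>] p_minus_eq[OF \<lambda>]
    hat_p_eq hat_lambda_eq
  have f: "\<And>y. 0 < a y \<Longrightarrow> (f has_real_derivative f' y) (at y)"
    and eq: "\<And>y. 0 < a y \<Longrightarrow> a y * f' y + H y (f y) = lam"
    using hf(1,3) by auto
  have "(f \<longlongrightarrow> P) (at x0 within {y. a y > 0})" if "\<forall>x\<in>{y. a y > 0}. f x \<ge> deriv u x"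
    using that
    by (intro tendsto_upper_root[OF \<mu> \<lambda> hlam f eq M super lip diff]) auto
  moreover have "(f \<longlongrightarrow> N) (at x0 within {y. a y > 0})" if "\<forall>x\<in>{y. a y > 0}. f x \<le> deriv u x"
    using that
    by (intro tendsto_lower_root[OF \<mu> \<lambda> hlam f eq M super lip diff]) auto
  moreover have "N\<^sub>0 \<le> m" "m \<le> P\<^sub>0" using \<mu> by (auto simp: level_interval_def)
  ultimately show ?thesis
    using level_interval_strict_mono[OF \<mu> \<lambda> hlam] min unfolding eqs by auto
qed

end
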